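(* Let $\ell>0$ and $\alpha=1/\sqrt2$. For each $N\ge1$ let $\tilde{x}_n=x_n^{\mathrm{GH}}/\beta$, $n=1,\ldots,N$, where $x_1^{\mathrm{GH}},\ldots,x_N^{\mathrm{GH}}$ are the nodes of the $N$-point Gauss--Hermite rule; let $\widetilde{w}_{k,1},\ldots,\widetilde{w}_{k,N}$ be the approximate kernel quadrature weights (which depend on $N$) defined in the context; and let $w_{k,1},\ldots,w_{k,N}$ be the Gaussian kernel quadrature weights at the nodes $\tilde{x}_1,\ldots,\tilde{x}_N$. Suppose that $$\sup_{N\ge1}\sum_{n=1}^N|\widetilde{w}_{k,n}|<\infty.$$ Then the quadrature rules $\widetilde{Q}_{k,N}(f)=\sum_{n=1}^N\widetilde{w}_{k,n}f(\tilde{x}_n)$ and $Q_{k,N}(f)=\sum_{n=1}^N w_{k,n}f(\tilde{x}_n)$ satisfy $$e(Q_{k,N})\le e(\widetilde{Q}_{k,N})=\mathcal{O}(\eta^N)\quad\text{as } N\to\infty$$ for some $0<\eta<1$.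
   Context: $\mu$ is the standard Gaussian measure on $\mathbb{R}$ and $\mu(f)=\int f\,\mathrm{d}\mu$. $k(x,y)=\exp(-(x-y)^2/(2\ell^2))$ is the Gaussian kernel with length-scale $\ell>0$, and $\mathcal{H}$ is its reproducing kernel Hilbert space of functions on $\mathbb{R}$. The worst-case error of a quadrature rule $Q(f)=\sum_{n=1}^N w_nf(x_n)$ is $e(Q)=\sup_{\|f\|_{\mathcal{H}}\le1}|\mu(f)-Q(f)|$. The kernel quadrature weights $w_k\in\mathbb{R}^N$ at distinct nodes $x_1,\ldots,x_N$ are the solution of $Kw_k=k_\mu$, where $[K]_{ij}=k(x_i,x_j)$ and $[k_\mu]_i=\int_{\mathbb{R}}k(x_i,x)\,\mathrm{d}\mu(x)$. $\mathrm{H}_n(x)=(-1)^ne^{x^2/2}\frac{\mathrm{d}^n}{\mathrm{d}x^n}e^{-x^2/2}$ are the probabilists' Hermite polynomials. The $N$-point Gauss--Hermite rule, with nodes $x_n^{\mathrm{GH}}$ (the roots of $\mathrm{H}_N$) and weights $w_n^{\mathrm{GH}}$, is the unique $N$-point rule that integrates all polynomials of degree at most $2N-1$ exactly with respect to $\mu$. With $\alpha=1/\sqrt2$, set $$\epsilon=\frac1{\sqrt2\,\ell},\qquad \beta=\Big(1+\Big(\frac{2\epsilon}{\alpha}\Big)^2\Big)^{1/4}=(1+8\epsilon^2)^{1/4},\qquad \delta^2=\frac{\alpha^2}{2}(\beta^2-1)=\frac14(\beta^2-1).$$ The approximate weights are $$\widetilde{w}_{k,n}=\Big(\frac1{1+2\delta^2}\Big)^{1/2}w_n^{\mathrm{GH}}e^{\delta^2\tilde{x}_n^2}\sum_{m=0}^{\lfloor(N-1)/2\rfloor}\frac1{2^mm!}\Big(\frac{2\alpha^2\beta^2}{1+2\delta^2}-1\Big)^m\mathrm{H}_{2m}(x_n^{\mathrm{GH}}),\qquad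 n=1,\ldots,N.$$ Equivalently, $\widetilde{Q}_{k,N}$ is the unique quadrature rule with nodes $\tilde x_1,\ldots,\tilde x_N$ that satisfies $\widetilde{Q}_{k,N}(\varphi_n^\alpha)=\mu(\varphi_n^\alpha)$ for $n=0,\ldots,N-1$, where $\varphi_n^\alpha(x)=\sqrt{\beta/n!}\,e^{-\delta^2x^2}\mathrm{H}_n(\sqrt2\alpha\beta x)$. *)

theory Defs
  imports "HOL-Probability.Probability"
begin

section \<open>Reproducing kernel Hilbert spaces of real-valued functions\<close>

text \<open>
  The space is given by its carrier \<open>H\<close>, a set of functions, and its inner product \<open>ip\<close>, of
  which only the values on \<open>H\<close> matter. For a given kernel there is at most one such pair up to
  the values of \<open>ip\<close> outside \<open>H\<close>.
\<close>

definition rkhs_norm :: "(('a \<Rightarrow> real) \<Rightarrow> ('a \<Rightarrow> real) \<Rightarrow> real) \<Rightarrow> ('a \<Rightarrow> real) \<Rightarrow> real" where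
  "rkhs_norm ip f = sqrt (ip f f)"

locale rkhs =
  fixes k :: "'a \<Rightarrow> 'a \<Rightarrow> real"
    and H :: "('a \<Rightarrow> real) set"
    and ip :: "('a \<Rightarrow> real) \<Rightarrow> ('a \<Rightarrow> real) \<Rightarrow> real"
  assumes zero_mem: "(\<lambda>x. 0) \<in> H"
    and add_mem: "\<lbrakk>f \<in> H; g \<in> H\<rbrakk> \<Longrightarrow> (\<lambda>x. f x + g x) \<in> H"
    and scale_mem: "f \<in> H \<Longrightarrow> (\<lambda>x. c * f x) \<in> H"
    and ip_commute: "\<lbrakk>f \<in> H; g \<in> H\<rbrakk> \<Longrightarrow> ip f g = ip g f"
    and ip_add_left: "\<lbrakk>f \<in> H; g \<in> H; h \<in> H\<rbrakk> \<Longrightarrow> ip (\<lambda>x. f x + g x) h = ip f h + ip g h"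
    and ip_scale_left: "\<lbrakk>f \<in> H; g \<in> H\<rbrakk> \<Longrightarrow> ip (\<lambda>x. c * f x) g = c * ip f g"
    and ip_nonneg: "f \<in> H \<Longrightarrow> 0 \<le> ip f f"
    and ip_definite: "\<lbrakk>f \<in> H; ip f f = 0\<rbrakk> \<Longrightarrow> f = (\<lambda>x. 0)"
    and complete:
      "\<lbrakk>\<And>n::nat. F n \<in> H;
        \<And>e. e > 0 \<Longrightarrow> \<exists>M. \<forall>m\<ge>M. \<forall>n\<ge>M. rkhs_norm ip (\<lambda>x. F m x - F n x) < e\<rbrakk>
       \<Longrightarrow> \<exists>f\<in>H. (\<lambda>n. rkhs_norm ip (\<lambda>x. F n x - f x)) \<longlonglongrightarrow> 0"
    and kernel_mem: "k x \<in> H"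
    and reproducing: "f \<in> H \<Longrightarrow> ip f (k x) = f x"
begin

lemma diff_mem: "\<lbrakk>f \<in> H; g \<in> H\<rbrakk> \<Longrightarrow> (\<lambda>x. f x - g x) \<in> H"
  using add_mem[OF _ scale_mem[of g "-1"], of f] by simp

lemma ip_diff_left:
  assumes "f \<in> H" "g \<in> H" "h \<in> H"
  shows "ip (\<lambda>x. f x - g x) h = ip f h - ip g h"
  using ip_add_left[OF assms(1) scale_mem[OF assms(2), of "-1"] assms(3)]
    ip_scale_left[OF assms(2,3), of "-1"] by simp

lemma ip_diff_right:
  assumes "f \<in> H" "g \<in> H" "h \<in> H"
  shows "ip h (\<lambda>x. f x - g x) = ip h f - ip h g"
  using ip_diff_left[OF assms] ip_commute[OF assms(3) diff_mem[OF assms(1,2)]]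
    ip_commute[OF assms(3) assms(1)] ip_commute[OF assms(3) assms(2)] by simp

lemma Cauchy_Schwarz:
  assumes f: "f \<in> H" and g: "g \<in> H"
  shows "\<bar>ip f g\<bar> \<le> rkhs_norm ip f * rkhs_norm ip g"
proof (cases "ip g g = 0")
  case True
  then have "g = (\<lambda>x. 0)" using ip_definite g by blast
  then have "ip g f = 0" using ip_scale_left[OF g f, of 0] by simp
  then have "ip f g = 0" using ip_commute f g by simp
  then show ?thesis using f g by (simp add: rkhs_norm_def ip_nonneg)
next
  case False
  then have gpos: "ip g g > 0" using ip_nonneg[OF g] by simp
  let ?c = "ip f g / ip g g"
  have cg: "(\<lambda>x. ?c * g x) \<in> H" using scale_mem g by blast
  have h: "(\<lambda>x. f x - ?c * g x) \<in> H" using diff_mem[OF f cg] .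
  have 1: "ip f (\<lambda>x. ?c * g x) = ?c * ip f g"
    unfolding ip_commute[OF f cg] ip_scale_left[OF g f] ip_commute[OF g f] ..
  have 2: "ip (\<lambda>x. ?c * g x) (\<lambda>x. ?c * g x) = ?c * (?c * ip g g)"
    unfolding ip_scale_left[OF g cg] ip_commute[OF g cg] ip_scale_left[OF g g] ..
  have 3: "ip (\<lambda>x. ?c * g x) f = ?c * ip f g"
    unfolding ip_scale_left[OF g f] ip_commute[OF g f] ..
  have "ip (\<lambda>x. f x - ?c * g x) (\<lambda>x. f x - ?c * g x) =
      ip f f - ?c * ip f g - (?c * ip f g - ?c * (?c * ip g g))"
    unfolding ip_diff_left[OF f cg h] ip_diff_right[OF f cg f] ip_diff_right[OF f cg cg] 1 2 3 ..
  also have "\<dots> = ip f f - (ip f g)\<^sup>2 / ip g g"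
    using gpos by (simp add: field_simps power2_eq_square)
  finally have "(ip f g)\<^sup>2 / ip g g \<le> ip f f"
    using ip_nonneg[OF h] by simp
  then have "(ip f g)\<^sup>2 \<le> ip f f * ip g g"
    using gpos by (simp add: field_simps)
  then have "sqrt ((ip f g)\<^sup>2) \<le> sqrt (ip f f * ip g g)" by (rule real_sqrt_le_mono)
  then show ?thesis by (simp add: rkhs_norm_def real_sqrt_mult)
qed

lemma kernel_commute: "k x y = k y x"
  using reproducing[OF kernel_mem, of x y] reproducing[OF kernel_mem, of y x]
    ip_commute[OF kernel_mem kernel_mem, of x y] by simp

lemma abs_eval_le: "f \<in> H \<Longrightarrow> \<bar>f x\<bar> \<le> rkhs_norm ip f * sqrt (k x x)"
  using Cauchy_Schwarz[OF _ kernel_mem, of f x] reproducing[of f x] reproducing[OF kernel_mem, of x x]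
  by (simp add: rkhs_norm_def)

lemma abs_eval_diff_le:
  assumes f: "f \<in> H"
  shows "\<bar>f x - f y\<bar> \<le> rkhs_norm ip f * sqrt (k x x - 2 * k x y + k y y)"
proof -
  let ?d = "\<lambda>z. k x z - k y z"
  have d: "?d \<in> H" using diff_mem[OF kernel_mem kernel_mem] .
  have "ip f ?d = f x - f y"
    using ip_diff_right[OF kernel_mem kernel_mem f, of x y] f by (simp add: reproducing)
  moreover have "ip ?d ?d = k x x - 2 * k x y + k y y"
    using ip_diff_right[OF kernel_mem kernel_mem d, of x y] d kernel_commute[of x y]
    by (simp add: reproducing)
  ultimately show ?thesis
    using Cauchy_Schwarz[OF f d] by (simp add: rkhs_norm_def)
qed

end


section \<open>Quadrature for the standard Gaussian measure\<close>

definition quad_rule :: "nat \<Rightarrow> (nat \<Rightarrow> real) \<Rightarrow> (nat \<Rightarrow> real) \<Rightarrow> (real \<Rightarrow> real) \<Rightarrow> real" where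
  "quad_rule N w x f = (\<Sum>n=1..N. w n * f (x n))"

definition worst_case_error ::
  "(real \<Rightarrow> real) set \<Rightarrow> ((real \<Rightarrow> real) \<Rightarrow> (real \<Rightarrow> real) \<Rightarrow> real)
    \<Rightarrow> ((real \<Rightarrow> real) \<Rightarrow> real) \<Rightarrow> real" where
  "worst_case_error H ip Q =
    (SUP f\<in>{f \<in> H. rkhs_norm ip f \<le> 1}. \<bar>(LINT x|std_normal_distribution. f x) - Q f\<bar>)"

definition gauss_kernel :: "real \<Rightarrow> real \<Rightarrow> real \<Rightarrow> real" where
  "gauss_kernel l x y = exp (- (x - y)\<^sup>2 / (2 * l\<^sup>2))"

definition kernel_quad_weights ::
  "(real \<Rightarrow> real \<Rightarrow> real) \<Rightarrow> nat \<Rightarrow> (nat \<Rightarrow> real) \<Rightarrow> (nat \<Rightarrow> real) \<Rightarrow> bool" where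
  "kernel_quad_weights k N x w \<longleftrightarrow>
    (\<forall>i\<in>{1..N}. (\<Sum>j=1..N. k (x i) (x j) * w j) = (LINT y|std_normal_distribution. k (x i) y))"

text \<open>
  For the Gaussian kernel the integral and the supremum in \<^const>\<open>worst_case_error\<close> take no
  default values: the functions of the space are integrable, and the set whose supremum is taken is
  nonempty and bounded.
\<close>

lemma gauss_rkhs_integrable:
  assumes "rkhs (gauss_kernel l) H ip" and f: "f \<in> H"
  shows "integrable std_normal_distribution f"
proof -
  interpret rkhs "gauss_kernel l" H ip by fact
  interpret real_distribution std_normal_distribution by (rule real_dist_normal_dist)
  let ?C = "rkhs_norm ip f"
  have "isCont f y" for y
  proof -
    have "isCont (\<lambda>x. ?C * sqrt (gauss_kernel l x x - 2 * gauss_kernel l x y + gauss_kernel l y y)) y"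
      unfolding gauss_kernel_def divide_inverse by (intro continuous_intros)
    then have "((\<lambda>x. ?C * sqrt (gauss_kernel l x x - 2 * gauss_kernel l x y + gauss_kernel l y y))
        \<longlongrightarrow> 0) (at y)" by (simp add: isCont_def gauss_kernel_def)
    then have "((\<lambda>x. f x - f y) \<longlongrightarrow> 0) (at y)"
      by (rule Lim_null_comparison[rotated]) (simp add: abs_eval_diff_le[OF f])
    then show ?thesis by (simp add: isCont_def LIM_zero_iff)
  qed
  then have "continuous_on UNIV f" by (simp add: continuous_at_imp_continuous_on)
  then have "f \<in> borel_measurable borel" by (rule borel_measurable_continuous_onI)
  moreover have "\<bar>f x\<bar> \<le> ?C" for x
    using abs_eval_le[OF f, of x] by (simp add: gauss_kernel_def)
  ultimately show ?thesis by (intro integrable_const_bound[where B = ?C]) auto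
qed

lemma gauss_rkhs_worst_case_error_bdd:
  assumes "rkhs (gauss_kernel l) H ip"
  shows "{f \<in> H. rkhs_norm ip f \<le> 1} \<noteq> {}"
    and "bdd_above ((\<lambda>f. \<bar>(LINT y|std_normal_distribution. f y) - quad_rule N w x f\<bar>)
      ` {f \<in> H. rkhs_norm ip f \<le> 1})"
proof -
  interpret rkhs "gauss_kernel l" H ip by fact
  interpret real_distribution std_normal_distribution by (rule real_dist_normal_dist)
  have "ip (\<lambda>x. 0) (\<lambda>x. 0) = 0"
    using ip_scale_left[OF zero_mem zero_mem, of 0] by simp
  then show "{f \<in> H. rkhs_norm ip f \<le> 1} \<noteq> {}"
    using zero_mem by (auto simp: rkhs_norm_def intro!: exI[of _ "\<lambda>x. 0"])
  have "\<bar>(LINT y|std_normal_distribution. f y) - quad_rule N w x f\<bar> \<le> 1 + (\<Sum>n=1..N. \<bar>w n\<bar>)"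
    if f: "f \<in> H" and n: "rkhs_norm ip f \<le> 1" for f
  proof -
    have b: "\<bar>f y\<bar> \<le> 1" for y
      using abs_eval_le[OF f, of y] n by (simp add: gauss_kernel_def)
    have "\<bar>LINT y|std_normal_distribution. f y\<bar> \<le> (LINT y|std_normal_distribution. \<bar>f y\<bar>)"
      by (rule integral_abs_bound)
    also have "\<dots> \<le> (LINT y|std_normal_distribution. 1)"
      using gauss_rkhs_integrable[OF assms f] b by (intro integral_mono) auto
    also have "\<dots> = 1" using prob_space by simp
    finally have 1: "\<bar>LINT y|std_normal_distribution. f y\<bar> \<le> 1" .
    have "\<bar>quad_rule N w x f\<bar> \<le> (\<Sum>n=1..N. \<bar>w n * f (x n)\<bar>)"
      unfolding quad_rule_def by (rule sum_abs)
    also have "\<dots> \<le> (\<Sum>n=1..N. \<bar>w n\<bar>)"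
      using b by (intro sum_mono) (auto simp: abs_mult intro: mult_left_le)
    finally show ?thesis using 1 by linarith
  qed
  then show "bdd_above ((\<lambda>f. \<bar>(LINT y|std_normal_distribution. f y) - quad_rule N w x f\<bar>)
      ` {f \<in> H. rkhs_norm ip f \<le> 1})"
    by (intro bdd_aboveI2) auto
qed


section \<open>Gauss--Hermite rules and the approximate weights\<close>

definition hermite :: "nat \<Rightarrow> real \<Rightarrow> real" where
  "hermite n x = (-1) ^ n * exp (x\<^sup>2 / 2) * (deriv ^^ n) (\<lambda>t. exp (- t\<^sup>2 / 2)) x"

text \<open>The rule is determined up to the numbering of its nodes, which is left arbitrary.\<close>

definition gauss_hermite_rule :: "nat \<Rightarrow> (nat \<Rightarrow> real) \<Rightarrow> (nat \<Rightarrow> real) \<Rightarrow> bool" where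
  "gauss_hermite_rule N x w \<longleftrightarrow>
    bij_betw x {1..N} {t. hermite N t = 0} \<and>
    (\<forall>p :: real poly. degree p \<le> 2 * N - 1 \<longrightarrow>
      quad_rule N w x (poly p) = (LINT t|std_normal_distribution. poly p t))"

text \<open>
  The parameters are those of the Mercer expansion of the Gaussian kernel with length-scale \<open>l\<close>,
  with the free parameter of that expansion fixed to \<open>gq_alpha\<close>.
\<close>

definition gq_alpha :: real where
  "gq_alpha = 1 / sqrt 2"

definition gq_eps :: "real \<Rightarrow> real" where
  "gq_eps l = 1 / (sqrt 2 * l)"

definition gq_beta :: "real \<Rightarrow> real" where
  "gq_beta l = (1 + (2 * gq_eps l / gq_alpha)\<^sup>2) powr (1 / 4)"

definition gq_delta2 :: "real \<Rightarrow> real" where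
  "gq_delta2 l = gq_alpha\<^sup>2 / 2 * ((gq_beta l)\<^sup>2 - 1)"

definition scaled_nodes :: "real \<Rightarrow> (nat \<Rightarrow> real) \<Rightarrow> nat \<Rightarrow> real" where
  "scaled_nodes l xGH n = xGH n / gq_beta l"

definition approx_weights ::
  "real \<Rightarrow> nat \<Rightarrow> (nat \<Rightarrow> real) \<Rightarrow> (nat \<Rightarrow> real) \<Rightarrow> nat \<Rightarrow> real" where
  "approx_weights l N xGH wGH n =
    sqrt (1 / (1 + 2 * gq_delta2 l)) * wGH n * exp (gq_delta2 l * (scaled_nodes l xGH n)\<^sup>2) *
    (\<Sum>m=0..(N - 1) div 2. 1 / (2 ^ m * fact m) *
      (2 * gq_alpha\<^sup>2 * (gq_beta l)\<^sup>2 / (1 + 2 * gq_delta2 l) - 1) ^ m * hermite (2 * m) (xGH n))"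

end

theory Submission
  imports Defs
begin

text \<open>
  Writing \<open>r = (\<beta>\<^sup>2 - 1) / (\<beta>\<^sup>2 + 1)\<close>, Mehler's formula expands the Gaussian kernel as
  \<open>k(x, y) = \<Sum>n. \<psi>\<^sub>n(x) \<psi>\<^sub>n(y)\<close> with
  \<open>\<psi>\<^sub>n(x)\<^sup>2 = \<surd>(1 - r\<^sup>2) r\<^sup>n H\<^sub>n(\<beta>x)\<^sup>2 e\<^bsup>-2\<delta>\<^sup>2x\<^sup>2\<^esup> / n!\<close>, and the approximate rule is exact on
  \<open>\<psi>\<^sub>0, \<dots>, \<psi>\<^bsub>N-1\<^esub>\<close>. Its squared error is therefore at most a constant times the mean of the tail
  \<open>T\<^sub>N = \<Sum>n\<ge>N. \<psi>\<^sub>n\<^sup>2 = 1 - \<Sum>n<N. \<psi>\<^sub>n\<^sup>2\<close> under the Gaussian measure, which is \<open>r\<^sup>N\<close>, plus its maximum over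
  the nodes. At the nodes \<open>\<bar>\<beta>x\<bar> \<le> 2\<surd>N\<close>, and comparing the tail with Mehler's formula for some
  \<open>s \<in> (r, 1)\<close> gives \<open>T\<^sub>N \<le> K \<rho>\<^sup>N\<close> with \<open>\<rho> = (r/s) exp(4 (s/(1+s) - r/(1+r)))\<close>. This is less than one since
  \<open>ln t - 4t/(1+t)\<close> has derivative \<open>(1-t)\<^sup>2 / (t (1+t)\<^sup>2)\<close>.
\<close>

section \<open>Hermite polynomials\<close>

text \<open>The recursion mirrors one differentiation of \<open>p(x) exp(-x^2/2)\<close> up to sign.
  As objects of type \<open>poly\<close> the Hermite functions have degrees and formal
  derivatives.\<close>

fun hermite_poly :: "nat \<Rightarrow> real poly" where
  "hermite_poly 0 = 1"
| "hermite_poly (Suc n) = [:0, 1:] * hermite_poly n - pderiv (hermite_poly n)"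

lemma higher_deriv_gaussian:
  "(deriv ^^ n) (\<lambda>t. exp (- t\<^sup>2 / 2)) = (\<lambda>x. (-1) ^ n * poly (hermite_poly n) x * exp (- x\<^sup>2 / 2) :: real)"
proof (induction n)
  case (Suc n)
  have "deriv (\<lambda>x. (-1) ^ n * poly (hermite_poly n) x * exp (- x\<^sup>2 / 2)) x
      = (-1) ^ Suc n * poly (hermite_poly (Suc n)) x * exp (- x\<^sup>2 / 2)" for x :: real
    by (rule DERIV_imp_deriv) (auto intro!: derivative_eq_intros poly_DERIV simp: algebra_simps)
  then show ?case unfolding funpow.simps comp_def Suc by (rule ext)
qed auto

lemma hermite_eq_poly: "hermite n x = poly (hermite_poly n) x"
proof -
  have "hermite n x = ((-1) ^ n * (-1) ^ n) * poly (hermite_poly n) x * (exp (x\<^sup>2 / 2) * exp (- x\<^sup>2 / 2))"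
    unfolding hermite_def higher_deriv_gaussian by simp
  also have "\<dots> = poly (hermite_poly n) x"
    by (simp flip: power_mult_distrib exp_add)
  finally show ?thesis .
qed

lemma degree_hermite_poly: "degree (hermite_poly n) \<le> n"
proof (induction n)
  case (Suc n)
  have "degree ([:0, 1:] * hermite_poly n) \<le> Suc n"
    using degree_mult_le[of "[:0, 1:]" "hermite_poly n"] Suc by simp
  moreover have "degree (pderiv (hermite_poly n)) \<le> Suc n"
    using Suc by (simp add: degree_pderiv)
  ultimately show ?case by (simp add: degree_diff_le)
qed auto

text \<open>Differentiating the recursion and inserting the induction hypothesis leaves
  \<open>H_n + n (x H_{n-1} - H_{n-1}')\<close>, and the bracket is again \<open>H_n\<close>. For
  \<open>n = 0\<close> the factor \<open>n\<close> hides the truncated subtraction.\<close>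

lemma pderiv_hermite_poly: "pderiv (hermite_poly n) = smult (real n) (hermite_poly (n - 1))"
proof (induction n)
  case (Suc n)
  show ?case
  proof (cases n)
    case (Suc m)
    have "pderiv (hermite_poly (Suc n)) =
        hermite_poly n + [:0, 1:] * pderiv (hermite_poly n) - pderiv (pderiv (hermite_poly n))"
      by (simp add: pderiv_diff pderiv_mult pderiv_pCons)
    also have "\<dots> = hermite_poly n + smult (real n) ([:0, 1:] * hermite_poly m - pderiv (hermite_poly m))"
      unfolding Suc.IH by (simp add: Suc pderiv_smult smult_diff_right)
    also have "[:0, 1:] * hermite_poly m - pderiv (hermite_poly m) = hermite_poly n"
      by (simp add: Suc)
    also have "hermite_poly n + smult (real n) (hermite_poly n) = smult (1 + real n) (hermite_poly n)"
      by (simp only: smult_add_left smult_1_left)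
    finally show ?thesis by simp
  qed (simp add: pderiv_pCons pderiv_diff)
qed auto

section \<open>Three-term recurrence, growth and location of the zeros\<close>

lemma hermite_0 [simp]: "hermite 0 x = 1"
  by (simp add: hermite_eq_poly)

lemma hermite_Suc: "hermite (Suc n) x = x * hermite n x - real n * hermite (n - 1) x"
  by (simp add: hermite_eq_poly pderiv_hermite_poly)

text \<open>For \<open>b n = |H_n(x)| / sqrt (n!)\<close> the recurrence has one coefficient
  \<open>|x| / sqrt (n + 2)\<close>, which tends to 0, and one below 1, so \<open>b\<close> is
  eventually slower than any \<open>q ^ n\<close>. The constant depends on \<open>x\<close>, which
  is enough for pointwise convergence of Mehler's series.\<close>

lemma hermite_growth:
  assumes "q > 1"
  obtains C where "C > 0" "\<And>n. \<bar>hermite n x\<bar> \<le> C * q ^ n * sqrt (fact n)"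
proof -
  define b where "b = (\<lambda>n. \<bar>hermite n x\<bar> / sqrt (fact n))"
  have b0: "b n \<ge> 0" for n by (simp add: b_def)
  have rec: "b (Suc (Suc n)) \<le> \<bar>x\<bar> / sqrt (real n + 2) * b (Suc n) + b n" for n
  proof -
    have "\<bar>hermite (Suc (Suc n)) x\<bar> \<le> \<bar>x\<bar> * \<bar>hermite (Suc n) x\<bar> + (real n + 1) * \<bar>hermite n x\<bar>"
      using abs_triangle_ineq4[of "x * hermite (Suc n) x" "(real n + 1) * hermite n x"]
      by (simp add: hermite_Suc[of "Suc n"] abs_mult add.commute)
    then have "b (Suc (Suc n)) \<le> (\<bar>x\<bar> * \<bar>hermite (Suc n) x\<bar> + (real n + 1) * \<bar>hermite n x\<bar>) / sqrt (fact (Suc (Suc n)))"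
      unfolding b_def by (intro divide_right_mono) auto
    also have "\<dots> = \<bar>x\<bar> / sqrt (real n + 2) * b (Suc n) + (real n + 1) / (sqrt (real n + 2) * sqrt (real n + 1)) * b n"
      by (simp add: b_def real_sqrt_mult add.commute
          add_divide_distrib[of "\<bar>x\<bar> * \<bar>hermite (Suc n) x\<bar>"])
    also have "(real n + 1) / (sqrt (real n + 2) * sqrt (real n + 1)) = sqrt (real n + 1) / sqrt (real n + 2)"
      by (simp only: mult.commute[of "sqrt (real n + 2)"] real_div_sqrt flip: divide_divide_eq_left)
    also have "\<bar>x\<bar> / sqrt (real n + 2) * b (Suc n) + sqrt (real n + 1) / sqrt (real n + 2) * b n \<le>
        \<bar>x\<bar> / sqrt (real n + 2) * b (Suc n) + 1 * b n"
      by (intro add_left_mono mult_right_mono b0) auto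
    finally show ?thesis by simp
  qed
  \<comment> \<open>From \<open>M\<close> on the first coefficient is below \<open>q - 1\<close>,
    and \<open>(q - 1) q^(n+1) + q^n\<close> is at most \<open>q^(n+2)\<close>.\<close>
  obtain M :: nat where M': "(\<bar>x\<bar> / (q - 1))\<^sup>2 < real M" using reals_Archimedean2 by blast
  have M: "\<bar>x\<bar> / sqrt (real n + 2) < q - 1" if "n \<ge> M" for n
  proof -
    have "(\<bar>x\<bar> / (q - 1))\<^sup>2 < real n + 2" using M' that by linarith
    then have "\<bar>x\<bar> / (q - 1) < sqrt (real n + 2)" by (rule real_less_rsqrt)
    then show ?thesis using assms by (simp add: field_simps)
  qed
  \<comment> \<open>The sum covers the indices up to \<open>M + 1\<close>, which the recurrence
    argument does not reach; the 1 makes \<open>C\<close> positive.\<close>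
  define C where "C = 1 + (\<Sum>n\<le>Suc M. b n)"
  have C: "C > 0" using b0 by (simp add: C_def add_pos_nonneg sum_nonneg)
  have small: "b n \<le> C * q ^ n" if "n \<le> Suc M" for n
  proof -
    have "b n \<le> (\<Sum>n\<le>Suc M. b n)" using that b0 by (intro member_le_sum) auto
    also have "\<dots> \<le> C * 1" by (simp add: C_def)
    also have "\<dots> \<le> C * q ^ n" using C assms by (intro mult_left_mono) auto
    finally show ?thesis .
  qed
  have "b n \<le> C * q ^ n \<and> b (Suc n) \<le> C * q ^ Suc n" for n
  proof (induction n)
    case 0
    show ?case using small[of 0] small[of 1] by simp
  next
    case (Suc n)
    have "b (Suc (Suc n)) \<le> C * q ^ Suc (Suc n)"
    proof (cases "n \<ge> M")
      case True
      have "b (Suc (Suc n)) \<le> \<bar>x\<bar> / sqrt (real n + 2) * b (Suc n) + b n" by (rule rec)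
      also have "\<dots> \<le> (q - 1) * (C * q ^ Suc n) + C * q ^ n"
        using M[OF True] Suc b0 assms by (intro add_mono mult_mono) auto
      also have "\<dots> \<le> (q - 1) * (C * q ^ Suc n) + C * q ^ Suc n"
        using assms C by (intro add_left_mono mult_left_mono power_increasing) auto
      also have "\<dots> = C * q ^ Suc (Suc n)" by (simp add: algebra_simps)
      finally show ?thesis .
    qed (use small[of "Suc (Suc n)"] in simp)
    then show ?case using Suc by simp
  qed
  then have "\<bar>hermite n x\<bar> \<le> C * q ^ n * sqrt (fact n)" for n
    by (simp add: b_def divide_simps mult_ac)
  with C show thesis by (rule that)
qed

text \<open>For \<open>\<bar>x\<bar> > 2\<surd>N\<close> the ratios \<open>\<bar>H\<^sub>n\<^sub>+\<^sub>1(x)\<bar> / \<bar>H\<^sub>n(x)\<bar>\<close> with \<open>n \<le> N\<close> stay above \<open>\<bar>x\<bar>/2\<close>, by the recurrence.\<close>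

lemma hermite_zero_bound:
  assumes "hermite N x = 0"
  shows "x\<^sup>2 \<le> 4 * real N"
proof (rule ccontr)
  assume "\<not> ?thesis"
  then have big: "x\<^sup>2 > 4 * real N" by simp
  then have x: "\<bar>x\<bar> > 0" by auto
  have "n \<le> N \<Longrightarrow> \<bar>hermite n x\<bar> > 0 \<and> \<bar>hermite (Suc n) x\<bar> \<ge> \<bar>x\<bar> / 2 * \<bar>hermite n x\<bar>" for n
  proof (induction n)
    case 0
    then show ?case by (simp add: hermite_Suc)
  next
    case (Suc n)
    let ?h = "\<bar>hermite (Suc n) x\<bar>"
    from Suc have IH: "\<bar>hermite n x\<bar> > 0" "\<bar>x\<bar> / 2 * \<bar>hermite n x\<bar> \<le> ?h" by auto
    have pos: "?h > 0" using IH x mult_pos_pos[of "\<bar>x\<bar> / 2" "\<bar>hermite n x\<bar>"] by linarith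
    \<comment> \<open>Since \<open>n + 1 \<le> N < x^2/4\<close>, the subtracted term of the
      recurrence consumes at most half of \<open>|x| |H_{n+1}(x)|\<close>.\<close>
    have "real (Suc n) * \<bar>hermite n x\<bar> \<le> real N * \<bar>hermite n x\<bar>"
      using Suc.prems by (intro mult_right_mono) auto
    also have "\<dots> \<le> x\<^sup>2 / 4 * \<bar>hermite n x\<bar>"
      using big by (intro mult_right_mono) auto
    also have "\<dots> = \<bar>x\<bar> / 2 * (\<bar>x\<bar> / 2 * \<bar>hermite n x\<bar>)"
      by (simp add: power2_eq_square)
    also have "\<dots> \<le> \<bar>x\<bar> / 2 * ?h" using IH by (intro mult_left_mono) auto
    finally have "real (Suc n) * \<bar>hermite n x\<bar> \<le> \<bar>x\<bar> / 2 * ?h" .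
    moreover have "\<bar>hermite (Suc (Suc n)) x\<bar> \<ge> \<bar>x\<bar> * ?h - real (Suc n) * \<bar>hermite n x\<bar>"
      using abs_triangle_ineq2[of "x * hermite (Suc n) x" "real (Suc n) * hermite n x"]
      by (simp add: hermite_Suc[of "Suc n"] abs_mult)
    ultimately show ?case using pos by (simp add: field_simps)
  qed
  from this[of N] assms show False by simp
qed

section \<open>Gaussian means of polynomials and exactness of the approximate weights\<close>

text \<open>The variance is free because multiplying the standard Gaussian density by
  \<open>exp(-\<delta>^2 y^2)\<close> gives, up to a constant, the Gaussian density with
  \<open>\<sigma>^2 = 1 / (1 + 2 \<delta>^2)\<close>.\<close>

definition gaussian_mean :: "real \<Rightarrow> real poly \<Rightarrow> real" where
  "gaussian_mean \<sigma> p = (LINT x|lborel. normal_density 0 \<sigma> x * poly p x)"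

context
  fixes \<sigma> :: real
  assumes sigma_pos: "\<sigma> > 0"
begin

lemma integrable_normal_poly: "integrable lborel (\<lambda>x. normal_density 0 \<sigma> x * poly p x)"
  using integrable_normal_moment[OF sigma_pos, of 0]
  by (auto simp: poly_altdef sum_distrib_left mult.left_commute intro!: Bochner_Integration.integrable_sum)

lemma gaussian_mean_add: "gaussian_mean \<sigma> (p + q) = gaussian_mean \<sigma> p + gaussian_mean \<sigma> q"
  by (simp add: gaussian_mean_def distrib_left integrable_normal_poly)

lemma gaussian_mean_smult: "gaussian_mean \<sigma> (smult c p) = c * gaussian_mean \<sigma> p"
  by (simp add: gaussian_mean_def mult.left_commute)

lemma gaussian_mean_diff: "gaussian_mean \<sigma> (p - q) = gaussian_mean \<sigma> p - gaussian_mean \<sigma> q"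
  by (simp add: gaussian_mean_def right_diff_distrib integrable_normal_poly)

lemma gaussian_mean_0: "gaussian_mean \<sigma> 0 = 0"
  by (simp add: gaussian_mean_def)

lemma gaussian_mean_1: "gaussian_mean \<sigma> 1 = 1"
  using sigma_pos by (simp add: gaussian_mean_def)

lemma gaussian_mean_sum: "gaussian_mean \<sigma> (sum f A) = (\<Sum>i\<in>A. gaussian_mean \<sigma> (f i))"
  by (induction A rule: infinite_finite_induct) (simp_all add: gaussian_mean_0 gaussian_mean_add)

text \<open>Read off from the closed forms of the moments: odd moments vanish, and consecutive even
  moments have ratio \<open>\<sigma>^2 n\<close>.\<close>

lemma gaussian_mean_monom_Suc:
  "gaussian_mean \<sigma> (monom c (Suc n)) = \<sigma>\<^sup>2 * gaussian_mean \<sigma> (pderiv (monom c n))"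
proof -
  let ?M = "\<lambda>k. LINT x|lborel. normal_density 0 \<sigma> x * x ^ k"
  have monom: "gaussian_mean \<sigma> (monom d k) = d * ?M k" for d k
    by (simp add: gaussian_mean_def poly_monom mult.left_commute)
  have even: "?M (2 * k) = fact (2 * k) / ((2 / \<sigma>\<^sup>2) ^ k * fact k)" for k
    using integral_normal_moment_even[OF sigma_pos, of 0 k] by simp
  have odd: "?M (2 * k + 1) = 0" for k
    using integral_normal_moment_odd[OF sigma_pos, of 0 k] by simp
  have "?M (Suc n) = \<sigma>\<^sup>2 * real n * ?M (n - 1)"
  proof (cases "even n")
    case True
    then obtain k where n: "n = 2 * k" by (rule evenE)
    then show ?thesis using odd[of k] odd[of "k - 1"] by (cases k) auto
  next
    case False
    then obtain k where n: "n = 2 * k + 1" by (rule oddE)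
    \<comment> \<open>The quotient of the closed forms at \<open>2 * Suc k\<close> and
      \<open>2 * k\<close>, with factorials and powers abstracted to variables.\<close>
    have cancel: "2 * t * (u * F) / ((2 / s * D) * (t * G)) = s * u * (F / (D * G))"
      if "t > 0" "s > 0" for t u F s D G :: real
      using that by (simp add: field_simps)
    have "fact (2 * Suc k) = 2 * (1 + real k) * ((2 * real k + 1) * fact (2 * k))"
      by (simp add: algebra_simps)
    then have "?M (2 * Suc k) = \<sigma>\<^sup>2 * (2 * real k + 1) * ?M (2 * k)"
      unfolding even power_Suc fact_Suc[of k] of_nat_Suc
      using cancel[of "1 + real k" "\<sigma>\<^sup>2"] sigma_pos by simp
    then show ?thesis by (simp add: n)
  qed
  then show ?thesis by (simp add: pderiv_monom monom)
qed

text \<open>Stein's identity. Both sides are linear in \<open>p\<close>, so the monomials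
  decide.\<close>

lemma gaussian_mean_by_parts:
  "gaussian_mean \<sigma> ([:0, 1:] * p) = \<sigma>\<^sup>2 * gaussian_mean \<sigma> (pderiv p)"
proof -
  have "gaussian_mean \<sigma> ([:0, 1:] * (\<Sum>i\<le>n. monom (coeff p i) i)) =
      \<sigma>\<^sup>2 * gaussian_mean \<sigma> (pderiv (\<Sum>i\<le>n. monom (coeff p i) i))" for n
  proof (induction n)
    case 0
    then show ?case using gaussian_mean_monom_Suc[of "coeff p 0" 0] by (simp add: monom_Suc)
  next
    case (Suc n)
    have "gaussian_mean \<sigma> (pCons 0 (p + q)) = gaussian_mean \<sigma> (pCons 0 p) + gaussian_mean \<sigma> (pCons 0 q)" for p q
      using gaussian_mean_add[of "pCons 0 p" "pCons 0 q"] by simp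
    with Suc show ?case using gaussian_mean_monom_Suc[of "coeff p (Suc n)" "Suc n"]
      by (simp add: monom_Suc[of _ "Suc n"] gaussian_mean_add pderiv_add distrib_left del: pderiv_monom)
  qed
  from this[of "degree p"] show ?thesis by (simp add: poly_as_sum_of_monoms)
qed

text \<open>Integration by parts turns the mean of \<open>b x H_n(b x)\<close> into
  \<open>b^2 \<sigma>^2 n\<close> times that of \<open>H_{n-1}(b x)\<close>; the other term of the
  recurrence contributes the \<open>-1\<close>.\<close>

lemma gaussian_mean_scaled_hermite_Suc:
  fixes b :: real and n :: nat
  defines "J \<equiv> \<lambda>n. gaussian_mean \<sigma> (pcompose (hermite_poly n) [:0, b:])"
  shows "J (Suc n) = real n * (b\<^sup>2 * \<sigma>\<^sup>2 - 1) * J (n - 1)"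
proof -
  let ?p = "\<lambda>n. pcompose (hermite_poly n) [:0, b:]"
  have "?p (Suc n) = smult b ([:0, 1:] * ?p n) - smult (real n) (?p (n - 1))"
    by (simp add: pcompose_diff pcompose_pCons pcompose_mult pderiv_hermite_poly pcompose_smult)
  then have "J (Suc n) = b * (\<sigma>\<^sup>2 * gaussian_mean \<sigma> (pderiv (?p n))) - real n * J (n - 1)"
    unfolding J_def by (simp only: gaussian_mean_diff gaussian_mean_smult gaussian_mean_by_parts)
  also have "pderiv (?p n) = smult (b * real n) (?p (n - 1))"
    by (simp add: pderiv_pcompose pderiv_hermite_poly pcompose_smult pderiv_pCons)
  finally show ?thesis by (simp add: gaussian_mean_smult J_def power2_eq_square algebra_simps)
qed

text \<open>The two-step recurrence is iterated from the values 1 and 0 at \<open>n = 0\<close> and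
  \<open>n = 1\<close>. These means are the source of the powers in the approximate weights.\<close>

lemma gaussian_mean_scaled_hermite:
  fixes b :: real
  shows "gaussian_mean \<sigma> (pcompose (hermite_poly n) [:0, b:]) =
    (if even n then fact n / (2 ^ (n div 2) * fact (n div 2)) * (b\<^sup>2 * \<sigma>\<^sup>2 - 1) ^ (n div 2) else 0)"
proof (induction n rule: less_induct)
  case (less n)
  show ?case
  proof (cases n)
    case 0
    then show ?thesis by (simp add: gaussian_mean_1 pcompose_1)
  next
    case (Suc m)
    show ?thesis
    proof (cases m)
      case 0
      then show ?thesis
        using gaussian_mean_scaled_hermite_Suc[of 0 b] Suc by simp
    next
      fix k assume m: "m = Suc k"
      show ?thesis
      proof (cases "even k")
        case True
        then obtain j where k: "k = 2 * j" by (rule evenE)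
        let ?q = "b\<^sup>2 * \<sigma>\<^sup>2 - 1"
        have cancel: "2 * t * (u * F) / (2 * D * (t * G)) * (q * Q) = u * q * (F / (D * G) * Q)"
          if "t > 0" for t u F q Q D G :: real
          using that by (simp add: field_simps)
        have "fact (2 * Suc j) = 2 * (1 + real j) * ((2 * real j + 1) * fact (2 * j))"
          by (simp add: algebra_simps)
        then have "fact (2 * Suc j) / (2 ^ Suc j * fact (Suc j)) * ?q ^ Suc j
            = (2 * real j + 1) * ?q * (fact (2 * j) / (2 ^ j * fact j) * ?q ^ j)"
          unfolding power_Suc fact_Suc[of j] of_nat_Suc using cancel[of "1 + real j"] by simp
        moreover have "gaussian_mean \<sigma> (pcompose (hermite_poly n) [:0, b:])
            = (2 * real j + 1) * ?q * gaussian_mean \<sigma> (pcompose (hermite_poly (2 * j)) [:0, b:])"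
          unfolding Suc gaussian_mean_scaled_hermite_Suc m k by (simp add: add.commute)
        moreover have "n = 2 * Suc j" using Suc m k by simp
        ultimately show ?thesis using less[of "2 * j"] by simp
      next
        case False
        then show ?thesis
          unfolding Suc gaussian_mean_scaled_hermite_Suc using less[of k] Suc m by simp
      qed
    qed
  qed
qed

end

text \<open>Integration by parts moves one step of the first index into a derivative of the second
  factor, which is \<open>n H_{n-1}\<close>. Descending to \<open>m = 0\<close> either collects
  \<open>n!\<close> or reaches 0.\<close>

lemma hermite_orthogonal:
  "gaussian_mean 1 (hermite_poly m * hermite_poly n) = (if m = n then fact n else 0)"
proof (induction m arbitrary: n)
  have parts: "gaussian_mean 1 (hermite_poly (Suc m) * p) = gaussian_mean 1 (hermite_poly m * pderiv p)" for m p
  proof -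
    have "hermite_poly (Suc m) * p = [:0, 1:] * (hermite_poly m * p) - pderiv (hermite_poly m) * p"
      by (simp add: algebra_simps)
    then show ?thesis
      by (simp only: gaussian_mean_diff gaussian_mean_by_parts zero_less_one)
        (simp add: pderiv_mult gaussian_mean_add mult.commute)
  qed
  {
    case 0
    show ?case
    proof (cases n)
      case (Suc k)
      then show ?thesis using parts[of k 1] by (simp add: gaussian_mean_0 pderiv_1)
    qed (simp add: gaussian_mean_1)
  next
    case (Suc m)
    have "gaussian_mean 1 (hermite_poly (Suc m) * hermite_poly n) =
        real n * gaussian_mean 1 (hermite_poly m * hermite_poly (n - 1))"
      by (simp only: parts pderiv_hermite_poly mult_smult_right gaussian_mean_smult zero_less_one)
    then show ?case by (cases n) (simp_all add: Suc)
  }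
qed

lemma LINT_std_normal_poly: "(LINT x|std_normal_distribution. poly p x) = gaussian_mean 1 p"
proof -
  have "(\<lambda>x. poly p x) \<in> borel_measurable borel"
    by (intro borel_measurable_continuous_onI continuous_intros)
  then show ?thesis
    unfolding gaussian_mean_def by (subst integral_density) auto
qed

section \<open>Parameters and exactness of the approximate rule\<close>

lemma gq_beta_sq: "(gq_beta l)\<^sup>2 = sqrt (1 + 4 / l\<^sup>2)"
proof -
  have "(a powr (1 / 4))\<^sup>2 = a powr (1 / 2)" for a :: real
    unfolding power2_eq_square powr_add[symmetric] by simp
  then have "(gq_beta l)\<^sup>2 = (1 + (2 * gq_eps l / gq_alpha)\<^sup>2) powr (1 / 2)"
    by (simp only: gq_beta_def)
  also have "(2 * gq_eps l / gq_alpha)\<^sup>2 = 4 / l\<^sup>2"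
    by (simp add: gq_eps_def gq_alpha_def power_divide power_mult_distrib)
  also have "(1 + 4 / l\<^sup>2) powr (1 / 2) = sqrt (1 + 4 / l\<^sup>2)"
    by (simp add: powr_half_sqrt)
  finally show ?thesis .
qed

lemma gq_beta_pos: "gq_beta l > 0"
proof -
  have "1 + (2 * gq_eps l / gq_alpha)\<^sup>2 > 0" by (intro add_pos_nonneg) auto
  then show ?thesis by (metis gq_beta_def powr_gt_zero less_irrefl)
qed

lemma gq_delta2_nonneg: "gq_delta2 l \<ge> 0"
  by (simp add: gq_delta2_def gq_beta_sq)

text \<open>At the scaled nodes the exponentials cancel and \<open>\<beta>\<close> disappears,
  leaving the Gauss-Hermite rule applied to \<open>S H_n\<close>. That rule is exact there, and
  orthogonality extracts the coefficient of \<open>H_n\<close> in \<open>S\<close>, which was chosen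
  to give the mean of \<open>H_n(\<beta> y)\<close> under the Gaussian of variance
  \<open>1/c\<close>.\<close>

lemma approx_weights_exact:
  fixes l :: real and n N :: nat
  assumes gh: "gauss_hermite_rule N x w" and n: "n < N"
  defines "\<phi> \<equiv> \<lambda>y. exp (- (gq_delta2 l * y\<^sup>2)) * hermite n (gq_beta l * y)"
  shows "quad_rule N (approx_weights l N x w) (scaled_nodes l x) \<phi> = (LINT y|std_normal_distribution. \<phi> y)"
proof -
  define c q where "c = 1 + 2 * gq_delta2 l" and "q = (gq_beta l)\<^sup>2 / c - 1"
  have c: "c > 0" using gq_delta2_nonneg[of l] by (simp add: c_def)
  define S where "S = (\<Sum>m=0..(N - 1) div 2. smult (q ^ m / (2 ^ m * fact m)) (hermite_poly (2 * m)))"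
  have S: "poly S t = (\<Sum>m=0..(N - 1) div 2. 1 / (2 ^ m * fact m) * q ^ m * hermite (2 * m) t)" for t
    by (simp add: S_def poly_sum hermite_eq_poly)
  have q: "2 * gq_alpha\<^sup>2 * (gq_beta l)\<^sup>2 / (1 + 2 * gq_delta2 l) - 1 = q"
    by (simp add: q_def c_def gq_alpha_def power_divide)
  have w: "approx_weights l N x w i = sqrt (1 / c) * w i * exp (gq_delta2 l * (scaled_nodes l x i)\<^sup>2) * poly S (x i)" for i
    unfolding approx_weights_def q S c_def ..
  have "degree S \<le> N - 1"
    unfolding S_def
  proof (intro degree_sum_le)
    fix m assume "m \<in> {0..(N - 1) div 2}"
    then have "2 * m \<le> N - 1" by auto
    then show "degree (smult (q ^ m / (2 ^ m * fact m)) (hermite_poly (2 * m))) \<le> N - 1"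
      using degree_smult_le[of _ "hermite_poly (2 * m)"] degree_hermite_poly[of "2 * m"]
      by (meson le_trans)
  qed simp
  \<comment> \<open>Both factors have degree at most \<open>N - 1\<close>, so the product stays
    within the range of exactness.\<close>
  then have deg: "degree (S * hermite_poly n) \<le> 2 * N - 1"
    using degree_mult_le[of S "hermite_poly n"] degree_hermite_poly[of n] n by linarith
  have "quad_rule N (approx_weights l N x w) (scaled_nodes l x) \<phi>
      = sqrt (1 / c) * quad_rule N w x (poly (S * hermite_poly n))"
    unfolding quad_rule_def sum_distrib_left
  proof (intro sum.cong refl)
    fix i
    have "gq_beta l * scaled_nodes l x i = x i"
      using gq_beta_pos[of l] by (simp add: scaled_nodes_def)
    then show "approx_weights l N x w i * \<phi> (scaled_nodes l x i) = sqrt (1 / c) * (w i * poly (S * hermite_poly n) (x i))"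
      unfolding \<phi>_def w by (simp add: hermite_eq_poly exp_minus)
  qed
  also have "quad_rule N w x (poly (S * hermite_poly n)) = gaussian_mean 1 (S * hermite_poly n)"
    using gh deg by (simp add: gauss_hermite_rule_def LINT_std_normal_poly)
  also have "\<dots> = (\<Sum>m=0..(N - 1) div 2. if 2 * m = n then q ^ m / (2 ^ m * fact m) * fact n else 0)"
    unfolding S_def sum_distrib_right mult_smult_left
    by (subst gaussian_mean_sum, simp, intro sum.cong refl) (simp add: gaussian_mean_smult hermite_orthogonal)
  also have "\<dots> = (if even n then fact n / (2 ^ (n div 2) * fact (n div 2)) * q ^ (n div 2) else 0)"
  proof (cases "even n")
    case True
    then obtain k where k: "n = 2 * k" by (rule evenE)
    \<comment> \<open>The truncation of the sum in the weights keeps every even index below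
      \<open>N\<close>.\<close>
    then have "k \<le> (N - 1) div 2" using n by linarith
    then show ?thesis using k by (simp add: sum.delta)
  next
    case False
    then have "2 * m \<noteq> n" for m by auto
    then show ?thesis using False by simp
  qed
  \<comment> \<open>With \<open>b = \<beta>\<close> and \<open>\<sigma>^2 = 1/c\<close> the quantity
    \<open>b^2 \<sigma>^2 - 1\<close> is \<open>q\<close>.\<close>
  also have "\<dots> = gaussian_mean (1 / sqrt c) (pcompose (hermite_poly n) [:0, gq_beta l:])"
    using c by (simp add: gaussian_mean_scaled_hermite q_def power_divide)
  also have "sqrt (1 / c) * \<dots> = (LINT y|lborel. std_normal_density y * \<phi> y)"
    unfolding gaussian_mean_def integral_mult_right_zero[symmetric]
  proof (intro Bochner_Integration.integral_cong refl)
    fix y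
    have "sqrt (1 / c) * normal_density 0 (1 / sqrt c) y = 1 / sqrt (2 * pi) * exp (- (c * y\<^sup>2 / 2))"
      using c by (simp add: normal_density_def power_divide real_sqrt_divide field_simps)
    also have "\<dots> = std_normal_density y * exp (- (gq_delta2 l * y\<^sup>2))"
      by (simp add: std_normal_density_def c_def algebra_simps add_divide_distrib flip: exp_add)
    finally show "sqrt (1 / c) * (normal_density 0 (1 / sqrt c) y * poly (pcompose (hermite_poly n) [:0, gq_beta l:]) y)
        = std_normal_density y * \<phi> y"
      by (simp add: \<phi>_def hermite_eq_poly poly_pcompose mult.commute[of y] flip: mult.assoc)
  qed
  also have "\<dots> = (LINT y|std_normal_distribution. \<phi> y)"
  proof -
    have "\<phi> \<in> borel_measurable borel"
      unfolding \<phi>_def hermite_eq_poly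
      by (intro borel_measurable_continuous_onI continuous_intros)
    then show ?thesis by (subst integral_density) auto
  qed
  finally show ?thesis .
qed

section \<open>Mehler's formula\<close>

text \<open>Each Hermite factor grows at most like \<open>q^n sqrt (n!)\<close> times
  \<open>sqrt (n + 1)\<close> for the index shift, so the terms are dominated by
  \<open>(n + 1) (q^2 |r|)^n\<close> for a \<open>q > 1\<close> with
  \<open>q^2 |r| < 1\<close>.\<close>

lemma summable_mehler_aux:
  fixes u v r :: real
  assumes r: "\<bar>r\<bar> < 1" and "i \<le> 1" "j \<le> 1"
  shows "summable (\<lambda>n. hermite (n + i) u * hermite (n + j) v / fact n * r ^ n)"
proof -
  have "\<exists>q>1. q\<^sup>2 * \<bar>r\<bar> < 1"
  proof (intro exI conjI)
    \<comment> \<open>With \<open>m = max |r| (1/2)\<close> this gives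
      \<open>q^2 |r| \<le> sqrt m < 1\<close>; the \<open>1/2\<close> avoids division by zero at
      \<open>r = 0\<close>.\<close>
    let ?q = "1 / sqrt (sqrt (max \<bar>r\<bar> (1/2)))"
    have "?q\<^sup>2 * \<bar>r\<bar> \<le> ?q\<^sup>2 * max \<bar>r\<bar> (1/2)" by (intro mult_left_mono) auto
    also have "\<dots> = sqrt (max \<bar>r\<bar> (1/2))" by (simp add: power_divide real_div_sqrt)
    also have "\<dots> < 1" using r by simp
    finally show "?q\<^sup>2 * \<bar>r\<bar> < 1" .
    show "?q > 1" using r by (simp add: field_simps)
  qed
  then obtain q where q: "q > 1" "q\<^sup>2 * \<bar>r\<bar> < 1" by auto
  obtain A where A: "A > 0" "\<And>n. \<bar>hermite n u\<bar> \<le> A * q ^ n * sqrt (fact n)" using hermite_growth[OF q(1)] by blast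
  obtain B where B: "B > 0" "\<And>n. \<bar>hermite n v\<bar> \<le> B * q ^ n * sqrt (fact n)" using hermite_growth[OF q(1)] by blast
  have growth: "\<bar>hermite (n + k) x\<bar> \<le> D * q * q ^ n * sqrt (fact n) * sqrt (real n + 1)"
    if D: "D > 0" "\<And>n. \<bar>hermite n x\<bar> \<le> D * q ^ n * sqrt (fact n)" and k: "k \<le> 1" for D x n k
  proof -
    have "\<bar>hermite (n + k) x\<bar> \<le> D * q ^ (n + k) * sqrt (fact (n + k))" by (rule D)
    also have "\<dots> \<le> D * q ^ Suc n * sqrt (fact (Suc n))"
      using D q k by (intro mult_mono power_increasing real_sqrt_le_mono fact_mono) auto
    also have "\<dots> = D * q * q ^ n * sqrt (fact n) * sqrt (real n + 1)"
      by (simp add: real_sqrt_mult add.commute mult_ac)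
    finally show ?thesis .
  qed
  have "summable (\<lambda>n. (real n + 1) * (q\<^sup>2 * \<bar>r\<bar>) ^ n)"
  proof -
    \<comment> \<open>The formal derivative of the geometric series.\<close>
    have "summable (\<lambda>n. diffs (\<lambda>_. 1) n * (q\<^sup>2 * \<bar>r\<bar>) ^ n)"
      by (rule termdiff_converges[of _ 1]) (use q in \<open>auto simp: abs_mult intro!: summable_geometric\<close>)
    then show ?thesis by (simp add: diffs_def add.commute)
  qed
  then have "summable (\<lambda>n. (A * q * (B * q)) * ((real n + 1) * (q\<^sup>2 * \<bar>r\<bar>) ^ n))" by (rule summable_mult)
  then show ?thesis
  proof (rule summable_comparison_test'[where N = 0])
    fix n :: nat
    have "\<bar>hermite (n + i) u\<bar> * \<bar>hermite (n + j) v\<bar> \<le>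
        (A * q * q ^ n * sqrt (fact n) * sqrt (real n + 1)) * (B * q * q ^ n * sqrt (fact n) * sqrt (real n + 1))"
      using A B q assms by (intro mult_mono growth) auto
    also have "\<dots> = fact n * ((A * q * (B * q)) * ((real n + 1) * (q\<^sup>2) ^ n))"
    proof -
      have "sqrt (fact n) * sqrt (fact n) = fact n" "sqrt (real n + 1) * sqrt (real n + 1) = real n + 1" "q ^ n * q ^ n = (q\<^sup>2) ^ n"
        by (simp_all add: power_mult_distrib power2_eq_square)
      moreover have "(A * q * Q * f * g) * (B * q * Q * f * g) = (f * f) * ((A * q * (B * q)) * ((g * g) * (Q * Q)))" for Q f g
        by (simp add: mult_ac)
      ultimately show ?thesis by (simp only:)
    qed
    finally have "\<bar>hermite (n + i) u\<bar> * \<bar>hermite (n + j) v\<bar> / fact n \<le> (A * q * (B * q)) * ((real n + 1) * (q\<^sup>2) ^ n)"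
      by (simp add: divide_le_eq mult.commute)
    then have "\<bar>hermite (n + i) u\<bar> * \<bar>hermite (n + j) v\<bar> / fact n * \<bar>r\<bar> ^ n \<le>
        (A * q * (B * q)) * ((real n + 1) * (q\<^sup>2) ^ n) * \<bar>r\<bar> ^ n"
      by (intro mult_right_mono) auto
    then show "norm (hermite (n + i) u * hermite (n + j) v / fact n * r ^ n) \<le>
        (A * q * (B * q)) * ((real n + 1) * (q\<^sup>2 * \<bar>r\<bar>) ^ n)"
      by (simp add: abs_mult power_abs power_mult_distrib mult_ac)
  qed
qed

text \<open>The shifts \<open>i\<close> and \<open>j\<close> are needed because differentiating
  Mehler's series in \<open>r\<close> raises both indices, and the three-term recurrence relates the
  shifted series to one another.\<close>

definition mehler_series :: "nat \<Rightarrow> nat \<Rightarrow> real \<Rightarrow> real \<Rightarrow> real \<Rightarrow> real" where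
  "mehler_series i j u v r = (\<Sum>n. hermite (n + i) u * hermite (n + j) v / fact n * r ^ n)"

lemma mehler_series_sums:
  assumes "\<bar>r\<bar> < 1" "i \<le> 1" "j \<le> 1"
  shows "(\<lambda>n. hermite (n + i) u * hermite (n + j) v / fact n * r ^ n) sums mehler_series i j u v r"
  unfolding mehler_series_def by (intro summable_sums summable_mehler_aux assms)

lemma mehler_series_commute: "mehler_series i j u v r = mehler_series j i v u r"
  by (simp add: mehler_series_def mult.commute)

text \<open>For \<open>n \<ge> 1\<close> the factor \<open>n\<close> lowers the factorial, so this
  is the old series with its index shifted; at \<open>n = 0\<close> the factor makes the value of
  \<open>f (n - 1)\<close> irrelevant.\<close>

lemma sums_shift_fact:
  fixes f :: "nat \<Rightarrow> real"
  assumes "(\<lambda>n. f n / fact n * r ^ n) sums S"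
  shows "(\<lambda>n. real n * f (n - 1) / fact n * r ^ n) sums (r * S)"
proof -
  have eq: "r * (f n / fact n * r ^ n) = real (Suc n) * f (Suc n - 1) / fact (Suc n) * r ^ Suc n" for n
    by (simp add: divide_simps del: of_nat_Suc)
  have "(\<lambda>n. real (Suc n) * f (Suc n - 1) / fact (Suc n) * r ^ Suc n) sums (r * S)"
    using sums_mult[OF assms, of r] by (simp only: eq)
  then show ?thesis by (subst (asm) sums_Suc_iff) simp
qed

text \<open>The recurrence is applied to \<open>H_{n+1}(u)\<close> term by term; its part with
  \<open>n H_{n-1}(u)\<close> is a shifted series.\<close>

lemma mehler_series_10:
  assumes r: "\<bar>r\<bar> < 1"
  shows "mehler_series 1 0 u v r = u * mehler_series 0 0 u v r - r * mehler_series 0 1 u v r"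
proof -
  have "u * (hermite (n + 0) u * hermite (n + 0) v / fact n * r ^ n)
        - real n * (hermite (n - 1 + 0) u * hermite (n - 1 + 1) v) / fact n * r ^ n
      = hermite (n + 1) u * hermite (n + 0) v / fact n * r ^ n" for n
  proof (cases "n = 0")
    case False
    have "x * (a * b / F * R) - m * (c * b) / F * R = (x * a - m * c) * b / F * R" for x a b c m F R :: real
      by (simp add: algebra_simps diff_divide_distrib)
    then show ?thesis using False hermite_Suc[of n u] by simp
  qed (simp add: hermite_Suc)
  moreover have "(\<lambda>n. u * (hermite (n + 0) u * hermite (n + 0) v / fact n * r ^ n)
        - real n * (hermite (n - 1 + 0) u * hermite (n - 1 + 1) v) / fact n * r ^ n)
      sums (u * mehler_series 0 0 u v r - r * mehler_series 0 1 u v r)"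
    by (intro sums_diff sums_mult mehler_series_sums sums_shift_fact r) auto
  ultimately show ?thesis using mehler_series_sums[OF r, of 1 0 u v] sums_unique2 by simp
qed

text \<open>The preceding relation and its mirror image under exchange of \<open>u\<close> and
  \<open>v\<close> form a linear system; the series with shifts \<open>1 0\<close> is
  eliminated.\<close>

lemma mehler_series_01:
  assumes r: "\<bar>r\<bar> < 1"
  shows "(1 - r\<^sup>2) * mehler_series 0 1 u v r = (v - r * u) * mehler_series 0 0 u v r"
proof -
  have "mehler_series 0 1 u v r = v * mehler_series 0 0 u v r - r * mehler_series 1 0 u v r"
    using mehler_series_10[OF r, of v u] by (simp add: mehler_series_commute[of _ _ u v])
  then show ?thesis unfolding mehler_series_10[OF r, of u v]
    by (simp add: power2_eq_square algebra_simps)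
qed

lemma mehler_series_11:
  assumes r: "\<bar>r\<bar> < 1"
  shows "(1 - r\<^sup>2) * mehler_series 1 1 u v r = (u - r * v) * mehler_series 0 1 u v r + r * mehler_series 0 0 u v r"
proof -
  let ?M = "\<lambda>i j. mehler_series i j u v r"
  let ?t = "\<lambda>i j n. hermite (n + i) u * hermite (n + j) v / fact n * r ^ n"
  \<comment> \<open>The series with shifts \<open>0 2\<close> is summed through the recurrence for
    \<open>H_{n+2}(v)\<close>, with its coefficient \<open>n + 1\<close> split into 1 and
    \<open>n\<close>.\<close>
  have "v * ?t 0 1 n - ?t 0 0 n - real n * (hermite (n - 1 + 1) u * hermite (n - 1 + 1) v) / fact n * r ^ n = ?t 0 2 n" for n
  proof (cases "n = 0")
    case False
    have "x * (a * b / F * R) - a * c / F * R - m * (a * c) / F * R = a * (x * b - (1 + m) * c) / F * R"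
      for x a b c m F R :: real
      by (simp add: algebra_simps diff_divide_distrib add_divide_distrib)
    then show ?thesis using False hermite_Suc[of "Suc n" v] by simp
  qed (simp add: hermite_Suc numeral_2_eq_2)
  moreover have "(\<lambda>n. v * ?t 0 1 n - ?t 0 0 n
      - real n * (hermite (n - 1 + 1) u * hermite (n - 1 + 1) v) / fact n * r ^ n)
      sums (v * ?M 0 1 - ?M 0 0 - r * ?M 1 1)"
    by (intro sums_diff sums_mult mehler_series_sums sums_shift_fact r) auto
  ultimately have *: "?t 0 2 sums (v * ?M 0 1 - ?M 0 0 - r * ?M 1 1)" by simp
  \<comment> \<open>The recurrence for \<open>H_{n+1}(u)\<close> expresses the series with shifts
    \<open>1 1\<close> through the one just summed, so that substitution yields an equation for
    it.\<close>
  have "u * ?t 0 1 n - real n * (hermite (n - 1 + 0) u * hermite (n - 1 + 2) v) / fact n * r ^ n = ?t 1 1 n" for n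
  proof (cases "n = 0")
    case False
    have "x * (a * b / F * R) - m * (c * b) / F * R = (x * a - m * c) * b / F * R" for x a b c m F R :: real
      by (simp add: algebra_simps diff_divide_distrib)
    moreover have "n - 1 + 2 = n + 1" using False by simp
    ultimately show ?thesis using hermite_Suc[of n u] by simp
  qed (simp add: hermite_Suc)
  moreover have "(\<lambda>n. u * ?t 0 1 n - real n * (hermite (n - 1 + 0) u * hermite (n - 1 + 2) v) / fact n * r ^ n)
      sums (u * ?M 0 1 - r * (v * ?M 0 1 - ?M 0 0 - r * ?M 1 1))"
    by (intro sums_diff sums_mult mehler_series_sums sums_shift_fact r *) auto
  ultimately have "?M 1 1 = u * ?M 0 1 - r * (v * ?M 0 1 - ?M 0 0 - r * ?M 1 1)"
    using mehler_series_sums[OF r, of 1 1 u v] sums_unique2 by simp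
  then show ?thesis by (simp add: power2_eq_square algebra_simps)
qed

lemma mehler_series_deriv:
  assumes r: "\<bar>r\<bar> < 1"
  shows "((mehler_series 0 0 u v) has_real_derivative mehler_series 1 1 u v r) (at r)"
proof -
  have "diffs (\<lambda>n. hermite n u * hermite n v / fact n) n = hermite (n + 1) u * hermite (n + 1) v / fact n" for n
    by (simp add: diffs_def divide_simps del: of_nat_Suc)
  moreover have "((\<lambda>z. \<Sum>n. hermite n u * hermite n v / fact n * z ^ n) has_field_derivative
      (\<Sum>n. diffs (\<lambda>n. hermite n u * hermite n v / fact n) n * r ^ n)) (at r)"
    using summable_mehler_aux[of _ 0 0 u v] r by (intro termdiffs_strong'[where K = 1]) auto
  ultimately show ?thesis by (simp add: mehler_series_def[abs_def])
qed

lemma mehler_formula: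
  fixes r u v :: real
  assumes r: "0 \<le> r" "r < 1"
  shows "(\<lambda>n. hermite n u * hermite n v / fact n * r ^ n) sums
    (exp ((2 * r * u * v - r\<^sup>2 * (u\<^sup>2 + v\<^sup>2)) / (2 * (1 - r\<^sup>2))) / sqrt (1 - r\<^sup>2))"
proof -
  define L where "L = (\<lambda>s::real. (2 * s * u * v - s\<^sup>2 * (u\<^sup>2 + v\<^sup>2)) / (2 * (1 - s\<^sup>2)))"
  \<comment> \<open>As a function of \<open>r\<close>, the series solves the linear differential equation of the closed form.\<close>
  define W where "W = (\<lambda>s. mehler_series 0 0 u v s * sqrt (1 - s\<^sup>2) * exp (- L s))"
  have "(W has_real_derivative 0) (at s)" if s: "\<bar>s\<bar> < 1" for s
  proof -
    have s2: "1 - s\<^sup>2 > 0" using s by (simp add: abs_square_less_1)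
    have dL: "(L has_real_derivative (u - s * v) * (v - s * u) / (1 - s\<^sup>2)\<^sup>2) (at s)"
    proof -
      have num: "((\<lambda>s. 2 * s * u * v - s\<^sup>2 * (u\<^sup>2 + v\<^sup>2)) has_real_derivative 2 * u * v - 2 * s * (u\<^sup>2 + v\<^sup>2)) (at s)"
        by (auto intro!: derivative_eq_intros)
      have den: "((\<lambda>s. 2 * (1 - s\<^sup>2)) has_real_derivative - 4 * s) (at s)"
        by (auto intro!: derivative_eq_intros)
      have nz: "2 * (1 - s\<^sup>2) \<noteq> 0" using s2 by simp
      have "(2 * u * v - 2 * s * (u\<^sup>2 + v\<^sup>2)) * (2 * (1 - s\<^sup>2)) - (2 * s * u * v - s\<^sup>2 * (u\<^sup>2 + v\<^sup>2)) * (- 4 * s)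
          = 4 * ((u - s * v) * (v - s * u))"
        by (simp add: power2_eq_square algebra_simps)
      moreover have "4 * a / (2 * P * (2 * P)) = a / P\<^sup>2" for a P :: real
        by (simp add: power2_eq_square)
      ultimately show ?thesis
        using DERIV_divide[OF num den nz] unfolding L_def by (simp only:)
    qed
    have dS: "((\<lambda>s. sqrt (1 - s\<^sup>2)) has_real_derivative - s / sqrt (1 - s\<^sup>2)) (at s)"
      using s2 by (auto intro!: derivative_eq_intros simp: field_simps)
    let ?F = "mehler_series 0 0 u v s"
    \<comment> \<open>The differential equation: the logarithmic derivative is that of
      \<open>exp (L s)\<close> plus \<open>s / (1 - s^2)\<close>, which comes from
      \<open>1 / sqrt (1 - s^2)\<close>.\<close>
    have "mehler_series 1 1 u v s = ((u - s * v) * (v - s * u) / (1 - s\<^sup>2)\<^sup>2 + s / (1 - s\<^sup>2)) * ?F"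
    proof -
      have P: "X = Y / (1 - s\<^sup>2)" if "(1 - s\<^sup>2) * X = Y" for X Y
        using that s2 by (metis nonzero_mult_div_cancel_left less_irrefl)
      have "mehler_series 1 1 u v s = ((u - s * v) * ((v - s * u) * ?F / (1 - s\<^sup>2)) + s * ?F) / (1 - s\<^sup>2)"
        using P[OF mehler_series_11[OF s, of u v]] P[OF mehler_series_01[OF s, of u v]] by (simp only:)
      also have "(a * (b * F / P) + s * F) / P = (a * b / P\<^sup>2 + s / P) * F" for a b F P :: real
        by (simp add: power2_eq_square add_divide_distrib algebra_simps)
      finally show ?thesis .
    qed
    moreover have "s / (1 - s\<^sup>2) * sqrt (1 - s\<^sup>2) = s / sqrt (1 - s\<^sup>2)"
      using s2 by (metis less_imp_le real_divide_square_eq real_sqrt_mult_self divide_divide_eq_left' abs_of_nonneg times_divide_eq_left mult.commute)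
    moreover have "(M * S + (- z / S) * F) - F * S * d = 0" if "M = (d + k) * F" "k * S = z / S" for M S z F d k :: real
    proof -
      have "- z / S = - (k * S)" using that by simp
      then show ?thesis by (simp only: that(1)) (simp add: algebra_simps)
    qed
    ultimately have "(mehler_series 1 1 u v s * sqrt (1 - s\<^sup>2) + (- s / sqrt (1 - s\<^sup>2)) * ?F)
        - ?F * sqrt (1 - s\<^sup>2) * ((u - s * v) * (v - s * u) / (1 - s\<^sup>2)\<^sup>2) = 0"
      by blast
    moreover have "(W has_real_derivative ((mehler_series 1 1 u v s * sqrt (1 - s\<^sup>2) + (- s / sqrt (1 - s\<^sup>2)) * ?F) * exp (- L s)
        + exp (- L s) * (- ((u - s * v) * (v - s * u) / (1 - s\<^sup>2)\<^sup>2)) * (?F * sqrt (1 - s\<^sup>2)))) (at s)"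
      unfolding W_def using s
      by (intro DERIV_mult mehler_series_deriv dS DERIV_fun_exp DERIV_minus dL) auto
    moreover have "(a + b) * e + e * (- d) * (F * S) = (a + b - F * S * d) * e" for a b e d F S :: real
      by (simp add: algebra_simps)
    ultimately show ?thesis by simp
  qed
  \<comment> \<open>\<open>W\<close> is constant on the open interval from -1 to 1, and at 0 only
    the term \<open>n = 0\<close> of the series survives.\<close>
  then have "W r = W 0"
    by (intro DERIV_isconst3[of "-1" 1]) (use r in auto)
  moreover have "W 0 = 1"
    using powser_zero[of "\<lambda>n. hermite n u * hermite n v / fact n"]
    by (simp add: W_def L_def mehler_series_def)
  ultimately have "mehler_series 0 0 u v r * sqrt (1 - r\<^sup>2) * exp (- L r) = 1"
    by (simp only: W_def)
  moreover have "sqrt (1 - r\<^sup>2) > 0" using r by (simp add: abs_square_less_1)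
  ultimately have "mehler_series 0 0 u v r = exp (L r) / sqrt (1 - r\<^sup>2)"
    by (simp add: exp_minus field_simps)
  then show ?thesis using mehler_series_sums[of r 0 0 u v] r by (simp add: L_def)
qed

section \<open>Quadrature errors in a reproducing kernel Hilbert space\<close>

context rkhs
begin

lemma sum_mem: "finite I \<Longrightarrow> (\<And>i. i \<in> I \<Longrightarrow> F i \<in> H) \<Longrightarrow> (\<lambda>x. \<Sum>i\<in>I. F i x) \<in> H"
proof (induction I rule: finite_induct)
  case (insert i I)
  then show ?case using add_mem[of "F i" "\<lambda>x. \<Sum>i\<in>I. F i x"] by simp
qed (simp add: zero_mem)

lemma ip_sum_left:
  "finite I \<Longrightarrow> (\<And>i. i \<in> I \<Longrightarrow> F i \<in> H) \<Longrightarrow> h \<in> H \<Longrightarrow> ip (\<lambda>x. \<Sum>i\<in>I. F i x) h = (\<Sum>i\<in>I. ip (F i) h)"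
proof (induction I rule: finite_induct)
  case empty
  then show ?case using ip_scale_left[OF zero_mem, of h 0] by simp
qed (simp add: ip_add_left sum_mem)

text \<open>The functional is represented by the combination \<open>g\<close> of kernel sections, so
  Cauchy-Schwarz applies and the double sum is the squared norm of \<open>g\<close>.\<close>

lemma discrete_functional_bound:
  assumes I: "finite I" and f: "f \<in> H"
  shows "(\<Sum>i\<in>I. a i * f (y i))\<^sup>2 \<le> (rkhs_norm ip f)\<^sup>2 * (\<Sum>i\<in>I. \<Sum>j\<in>I. a i * a j * k (y i) (y j))"
proof -
  define g where "g = (\<lambda>x. \<Sum>i\<in>I. a i * k (y i) x)"
  have mem: "(\<lambda>x. a i * k (y i) x) \<in> H" for i by (intro scale_mem kernel_mem)
  have g: "g \<in> H" unfolding g_def by (intro sum_mem I mem)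
  have ip_g: "ip h g = (\<Sum>i\<in>I. a i * h (y i))" if h: "h \<in> H" for h
  proof -
    have "ip h g = (\<Sum>i\<in>I. ip (\<lambda>x. a i * k (y i) x) h)"
      unfolding ip_commute[OF h g] unfolding g_def by (intro ip_sum_left I mem h)
    also have "\<dots> = (\<Sum>i\<in>I. a i * h (y i))"
      using h kernel_mem by (intro sum.cong refl) (simp add: ip_scale_left ip_commute[of "k _"] reproducing)
    finally show ?thesis .
  qed
  have "ip g g = (\<Sum>i\<in>I. \<Sum>j\<in>I. a i * a j * k (y i) (y j))"
    unfolding ip_g[OF g] unfolding g_def
    by (simp add: sum_distrib_left mult.assoc kernel_commute)
  moreover have "(ip f g)\<^sup>2 \<le> (rkhs_norm ip f)\<^sup>2 * (rkhs_norm ip g)\<^sup>2"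
    using power_mono[OF Cauchy_Schwarz[OF f g], of 2] by (simp add: power_mult_distrib)
  moreover have "(rkhs_norm ip g)\<^sup>2 = ip g g" using ip_nonneg[OF g] by (simp add: rkhs_norm_def)
  ultimately show ?thesis using ip_g[OF f] by simp
qed

text \<open>
  The residual is \<open>f\<close> minus its orthogonal projection onto the span of the kernel sections at the
  points of \<open>S\<close>.
\<close>

lemma interpolation_residual:
  assumes "finite S" "f \<in> H"
  shows "\<exists>c. \<forall>s\<in>S. f s - (\<Sum>t\<in>S. c t * k t s) = 0"
  using assms
proof (induction S arbitrary: f rule: finite_induct)
  case empty
  then show ?case by simp
next
  case (insert z S)
  note fin = \<open>finite S\<close>
  have mem: "(\<lambda>x. c t * k t x) \<in> H" for c t by (intro scale_mem kernel_mem)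
  have res: "(\<lambda>x. f x - (\<Sum>t\<in>S. c t * k t x)) \<in> H" if "f \<in> H" for f c
    using that by (intro diff_mem sum_mem fin mem)
  obtain c where c: "\<And>s. s \<in> S \<Longrightarrow> f s - (\<Sum>t\<in>S. c t * k t s) = 0"
    using insert by blast
  obtain d where d: "\<And>s. s \<in> S \<Longrightarrow> k z s - (\<Sum>t\<in>S. d t * k t s) = 0"
    using insert.IH[of "k z"] kernel_mem by blast
  define g where "g = (\<lambda>x. f x - (\<Sum>t\<in>S. c t * k t x))"
  define h where "h = (\<lambda>x. k z x - (\<Sum>t\<in>S. d t * k t x))"
  have gH: "g \<in> H" and hH: "h \<in> H" unfolding g_def h_def using insert.prems by (simp_all add: res kernel_mem)
  have g0: "g s = 0" and h0: "h s = 0" if "s \<in> S" for s using c[OF that] d[OF that] by (auto simp: g_def h_def)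
  have ip_h: "ip e h = e z - (\<Sum>t\<in>S. d t * e t)" if e: "e \<in> H" for e
  proof -
    have "ip e h = ip e (k z) - ip e (\<lambda>x. \<Sum>t\<in>S. d t * k t x)"
      unfolding h_def by (intro ip_diff_right kernel_mem sum_mem fin mem e)
    also have "ip e (\<lambda>x. \<Sum>t\<in>S. d t * k t x) = ip (\<lambda>x. \<Sum>t\<in>S. d t * k t x) e"
      by (intro ip_commute sum_mem fin mem e)
    also have "\<dots> = (\<Sum>t\<in>S. ip (\<lambda>x. d t * k t x) e)"
      by (intro ip_sum_left fin mem e)
    also have "\<dots> = (\<Sum>t\<in>S. d t * e t)"
      using e kernel_mem by (intro sum.cong refl) (simp add: ip_scale_left ip_commute[of "k _"] reproducing)
    finally show ?thesis by (simp add: reproducing e)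
  qed
  \<comment> \<open>A Gram-Schmidt step: subtracting \<open>m h\<close> makes the residual vanish at
    \<open>z\<close> too and keeps its zeros on \<open>S\<close>. If \<open>h z = 0\<close>, the
    default value is \<open>m = 0\<close>.\<close>
  define m where "m = g z / h z"
  have gz: "g z = m * h z"
  proof (cases "h z = 0")
    case True
    \<comment> \<open>Here \<open>k z\<close> already lies in the span of the earlier sections, and
      \<open>g z = ip g h = 0\<close>.\<close>
    then have "ip h h = 0" using ip_h[OF hH] h0 by simp
    then have "h = (\<lambda>x. 0)" using ip_definite hH by blast
    then have "ip g h = 0" using ip_scale_left[OF hH gH, of 0] ip_commute[OF gH hH] by simp
    then show ?thesis using ip_h[OF gH] g0 True by simp
  qed (simp add: m_def)
  define e where "e = (\<lambda>t. if t = z then m else c t - m * d t)"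
  have "f s - (\<Sum>t\<in>insert z S. e t * k t s) = g s - m * h s" for s
  proof -
    have "(\<Sum>t\<in>insert z S. e t * k t s) = m * k z s + (\<Sum>t\<in>S. (c t - m * d t) * k t s)"
      using insert.hyps by (auto simp: e_def intro!: sum.cong)
    then show ?thesis
      by (simp add: g_def h_def left_diff_distrib sum_subtractf sum_distrib_left right_diff_distrib mult.assoc)
  qed
  then show ?case using gz g0 h0 by (intro exI[of _ e]) auto
qed

text \<open>The quadratic form of the kernel is the sum of all \<open>P n\<close>. The first
  \<open>N\<close> are kept, the others are replaced by the weighted Cauchy-Schwarz bound
  \<open>R n\<close>; since the kernel is 1 on the diagonal, all \<open>R n\<close> together sum to
  the square of \<open>?A\<close>.\<close>

lemma mercer_discrete_bound:
  assumes mercer: "\<And>x y. (\<lambda>n. \<psi> n x * \<psi> n y) sums k x y" and diag: "\<And>x. k x x = 1"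
    and I: "finite I" and f: "f \<in> H"
  shows "(\<Sum>i\<in>I. a i * f (y i))\<^sup>2 \<le> (rkhs_norm ip f)\<^sup>2 *
    ((\<Sum>n<N. (\<Sum>i\<in>I. a i * \<psi> n (y i))\<^sup>2) +
      (\<Sum>i\<in>I. \<bar>a i\<bar>) * (\<Sum>i\<in>I. \<bar>a i\<bar> * (1 - (\<Sum>n<N. (\<psi> n (y i))\<^sup>2))))"
proof -
  let ?A = "\<Sum>i\<in>I. \<bar>a i\<bar>"
  define P where "P = (\<lambda>n. (\<Sum>i\<in>I. a i * \<psi> n (y i))\<^sup>2)"
  define R where "R = (\<lambda>n. ?A * (\<Sum>i\<in>I. \<bar>a i\<bar> * (\<psi> n (y i))\<^sup>2))"
  have "(\<lambda>n. \<Sum>i\<in>I. \<Sum>j\<in>I. a i * a j * (\<psi> n (y i) * \<psi> n (y j))) sums (\<Sum>i\<in>I. \<Sum>j\<in>I. a i * a j * k (y i) (y j))"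
    by (intro sums_sum sums_mult mercer)
  also have "(\<lambda>n. \<Sum>i\<in>I. \<Sum>j\<in>I. a i * a j * (\<psi> n (y i) * \<psi> n (y j))) = P"
    by (simp add: P_def power2_eq_square sum_product mult_ac)
  finally have P: "P sums (\<Sum>i\<in>I. \<Sum>j\<in>I. a i * a j * k (y i) (y j))" .
  have "(\<lambda>n. ?A * (\<Sum>i\<in>I. \<bar>a i\<bar> * (\<psi> n (y i) * \<psi> n (y i)))) sums (?A * (\<Sum>i\<in>I. \<bar>a i\<bar> * k (y i) (y i)))"
    by (intro sums_sum sums_mult mercer)
  then have "R sums (?A * ?A)" by (simp add: R_def power2_eq_square diag)
  \<comment> \<open>This correction exchanges \<open>R n\<close> for \<open>P n\<close> at the first
    \<open>N\<close> indices.\<close>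
  moreover have "(\<lambda>n. if n \<in> {..<N} then P n - R n else 0) sums (\<Sum>n<N. P n - R n)"
    by (rule sums_If_finite_set) simp
  ultimately have R: "(\<lambda>n. R n + (if n \<in> {..<N} then P n - R n else 0)) sums (?A * ?A + (\<Sum>n<N. P n - R n))"
    by (rule sums_add)
  have PR: "P n \<le> R n" for n
  proof -
    have eq: "a i * \<psi> n (y i) = sqrt \<bar>a i\<bar> * (sqrt \<bar>a i\<bar> * (sgn (a i) * \<psi> n (y i)))" for i
      by (cases "a i" "0 :: real" rule: linorder_cases) (simp_all flip: mult.assoc)
    have "P n = (\<Sum>i\<in>I. sqrt \<bar>a i\<bar> * (sqrt \<bar>a i\<bar> * (sgn (a i) * \<psi> n (y i))))\<^sup>2"
      unfolding P_def by (intro arg_cong[where f = "\<lambda>t. t\<^sup>2"] sum.cong refl eq)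
    also have "\<dots> \<le> (\<Sum>i\<in>I. (sqrt \<bar>a i\<bar>)\<^sup>2) * (\<Sum>i\<in>I. (sqrt \<bar>a i\<bar> * (sgn (a i) * \<psi> n (y i)))\<^sup>2)"
      by (rule Cauchy_Schwarz_ineq_sum)
    also have "\<dots> = R n"
      unfolding R_def by (intro arg_cong2[where f = "(*)"] sum.cong refl) (auto simp: power_mult_distrib sgn_if)
    finally show ?thesis .
  qed
  have "(\<Sum>i\<in>I. \<Sum>j\<in>I. a i * a j * k (y i) (y j)) \<le> ?A * ?A + (\<Sum>n<N. P n - R n)"
    by (rule sums_le[OF _ P R]) (use PR in auto)
  also have "(\<Sum>n<N. R n) = ?A * (\<Sum>i\<in>I. \<bar>a i\<bar> * (\<Sum>n<N. (\<psi> n (y i))\<^sup>2))"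
    unfolding R_def by (subst sum_distrib_left[symmetric], subst sum.swap) (simp add: sum_distrib_left)
  then have "?A * ?A + (\<Sum>n<N. P n - R n) =
      (\<Sum>n<N. P n) + ?A * (\<Sum>i\<in>I. \<bar>a i\<bar> * (1 - (\<Sum>n<N. (\<psi> n (y i))\<^sup>2)))"
    by (simp add: sum_subtractf right_diff_distrib)
  finally have "(\<Sum>i\<in>I. \<Sum>j\<in>I. a i * a j * k (y i) (y j)) \<le>
      (\<Sum>n<N. P n) + ?A * (\<Sum>i\<in>I. \<bar>a i\<bar> * (1 - (\<Sum>n<N. (\<psi> n (y i))\<^sup>2)))" .
  then have "(rkhs_norm ip f)\<^sup>2 * (\<Sum>i\<in>I. \<Sum>j\<in>I. a i * a j * k (y i) (y j)) \<le> (rkhs_norm ip f)\<^sup>2 *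
      ((\<Sum>n<N. P n) + ?A * (\<Sum>i\<in>I. \<bar>a i\<bar> * (1 - (\<Sum>n<N. (\<psi> n (y i))\<^sup>2))))"
    by (rule mult_left_mono) simp
  with discrete_functional_bound[OF I f, of a y] show ?thesis unfolding P_def by linarith
qed

end

section \<open>Discretisation of a probability measure\<close>

lemma (in real_distribution) integral_simple_compose:
  fixes g :: "real \<Rightarrow> real"
  assumes F: "simple_function M F"
  shows "(LINT x|M. g (F x)) = (\<Sum>v\<in>range F. measure M {x. F x = v} * g v)"
proof -
  have fin: "finite (range F)" using F by (simp add: simple_function_def)
  have meas: "{x. F x = v} \<in> sets M" for v
    using simple_functionD(2)[OF F, of "{v}"] by (simp add: vimage_def)
  have "g (F x) = (\<Sum>v\<in>range F. g v * indicator {x. F x = v} x)" for x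
  proof -
    have "(\<Sum>v\<in>range F. g v * indicator {x. F x = v} x) = (\<Sum>v\<in>{F x}. g v * indicator {x. F x = v} x)"
      by (rule sum.mono_neutral_right[OF fin]) (auto simp: indicator_def)
    then show ?thesis by simp
  qed
  then have "(LINT x|M. g (F x)) = (LINT x|M. (\<Sum>v\<in>range F. g v * indicator {x. F x = v} x))"
    by simp
  also have "\<dots> = (\<Sum>v\<in>range F. measure M {x. F x = v} * g v)"
    using meas by (subst Bochner_Integration.integral_sum) (auto simp: mult.commute less_top[symmetric])
  finally show ?thesis by simp
qed

text \<open>Dominated convergence along simple functions tending to the identity. One sequence
  serves all \<open>g\<close>, so that \<open>f\<close>, the Mercer functions and the tail can be
  passed to the limit together.\<close>

lemma (in real_distribution) integral_simple_approximation:
  obtains F where "\<And>m::nat. simple_function M (F m)"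
    and "\<And>g :: real \<Rightarrow> real. continuous_on UNIV g \<Longrightarrow> (\<And>x. \<bar>g x\<bar> \<le> 1) \<Longrightarrow>
      (\<lambda>m. LINT x|M. g (F m x)) \<longlonglongrightarrow> (LINT x|M. g x)"
proof -
  have "(\<lambda>x. x) \<in> borel_measurable M" by simp
  from borel_measurable_implies_sequence_metric[OF this, of 0] obtain F
    where F: "\<And>m::nat. simple_function M (F m)" "\<And>x. (\<lambda>m. F m x) \<longlonglongrightarrow> x" by auto
  show thesis
  proof (rule that[of F])
    fix g :: "real \<Rightarrow> real" assume g: "continuous_on UNIV g" "\<And>x. \<bar>g x\<bar> \<le> 1"
    have gm: "g \<in> borel_measurable borel" using g(1) by (rule borel_measurable_continuous_onI)
    show "(\<lambda>m. LINT x|M. g (F m x)) \<longlonglongrightarrow> (LINT x|M. g x)"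
    proof (rule integral_dominated_convergence[where w = "\<lambda>_. 1"])
      show "AE x in M. (\<lambda>m. g (F m x)) \<longlonglongrightarrow> g x"
        using continuous_on_tendsto_compose[OF g(1) F(2)] by simp
      show "(\<lambda>x. g (F m x)) \<in> borel_measurable M" for m
        using measurable_compose[OF borel_measurable_simple_function[OF F(1)] gm] by simp
    qed (use g gm in auto)
  qed (rule F)
qed

text \<open>
  A probability measure is handled by discretising it along simple functions converging to the
  identity, so that no Bochner integral of kernel sections is needed.
\<close>

lemma mercer_error_bound:
  fixes k :: "real \<Rightarrow> real \<Rightarrow> real"
  assumes rkhs: "rkhs k H ip" and distr: "real_distribution M"
    and mercer: "\<And>x y. (\<lambda>n. \<psi> n x * \<psi> n y) sums k x y" and diag: "\<And>x. k x x = 1"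
    and cont: "\<And>n. continuous_on UNIV (\<psi> n)"
    and f: "f \<in> H" "rkhs_norm ip f \<le> 1" "continuous_on UNIV f"
  shows "((LINT x|M. f x) - quad_rule Q w x f)\<^sup>2 \<le>
    (\<Sum>n<N. ((LINT x|M. \<psi> n x) - quad_rule Q w x (\<psi> n))\<^sup>2) +
    (1 + (\<Sum>i=1..Q. \<bar>w i\<bar>)) *
      ((LINT x|M. 1 - (\<Sum>n<N. (\<psi> n x)\<^sup>2)) + (\<Sum>i=1..Q. \<bar>w i\<bar> * (1 - (\<Sum>n<N. (\<psi> n (x i))\<^sup>2))))"
proof -
  interpret rkhs k H ip by fact
  interpret real_distribution M by fact
  let ?T = "\<lambda>x. 1 - (\<Sum>n<N. (\<psi> n x)\<^sup>2)"
  \<comment> \<open>Bessel's inequality: the terms are nonnegative and the full series has sum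
    \<open>k x x = 1\<close>.\<close>
  have partial: "(\<Sum>n\<in>A. (\<psi> n x)\<^sup>2) \<le> 1" if "finite A" for A x
  proof -
    have s: "(\<lambda>n. (\<psi> n x)\<^sup>2) sums 1" using mercer[of x x] diag by (simp add: power2_eq_square)
    have "(\<Sum>n\<in>A. (\<psi> n x)\<^sup>2) \<le> (\<Sum>n. (\<psi> n x)\<^sup>2)"
      by (rule sum_le_suminf) (use s that in \<open>auto simp: sums_iff\<close>)
    then show ?thesis using s by (simp add: sums_iff)
  qed
  have psi1: "\<bar>\<psi> n x\<bar> \<le> 1" for n x
    using partial[of "{n}" x] by (simp add: abs_square_le_1)
  have T1: "\<bar>?T x\<bar> \<le> 1" for x
    using partial[of "{..<N}" x] sum_nonneg[of "{..<N}" "\<lambda>n. (\<psi> n x)\<^sup>2"] by auto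
  have f1: "\<bar>f x\<bar> \<le> 1" for x using abs_eval_le[OF f(1), of x] f(2) diag by simp
  have Tc: "continuous_on UNIV ?T" by (intro continuous_intros cont)
  obtain F where F: "\<And>m::nat. simple_function M (F m)"
    and lim: "\<And>g :: real \<Rightarrow> real. continuous_on UNIV g \<Longrightarrow> (\<And>x. \<bar>g x\<bar> \<le> 1) \<Longrightarrow>
      (\<lambda>m. LINT x|M. g (F m x)) \<longlonglongrightarrow> (LINT x|M. g x)"
    using integral_simple_approximation by blast
  define L where "L = (\<lambda>m g. (LINT x|M. g (F m x)) - quad_rule Q w x g)"
  define V where "V = (\<Sum>i=1..Q. \<bar>w i\<bar>)"
  define W where "W = (\<lambda>m. (LINT x|M. ?T (F m x)) + (\<Sum>i=1..Q. \<bar>w i\<bar> * ?T (x i)))"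
  have "(L m f)\<^sup>2 \<le> (\<Sum>n<N. (L m (\<psi> n))\<^sup>2) + (1 + V) * W m" for m
  proof -
    \<comment> \<open>The discretised error is one finite functional: values of \<open>F m\<close>
      weighted by their probabilities, and nodes weighted by \<open>- w i\<close>. The disjoint sum
      keeps coinciding points apart.\<close>
    define I where "I = range (F m) <+> {1..Q}"
    define a where "a = case_sum (\<lambda>v. measure M {x. F m x = v}) (\<lambda>i. - w i)"
    define y where "y = case_sum (\<lambda>v. v) x"
    have fin: "finite (range (F m))" using F[of m] by (auto simp: simple_function_def)
    have I: "finite I" using fin by (simp add: I_def)
    have sumI: "(\<Sum>i\<in>I. G i) = (\<Sum>v\<in>range (F m). G (Inl v)) + (\<Sum>i=1..Q. G (Inr i))" for G :: "_ \<Rightarrow> real"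
      unfolding I_def using fin by (simp add: sum.Plus)
    have La: "(\<Sum>i\<in>I. a i * g (y i)) = L m g" for g
      by (simp add: sumI L_def a_def y_def integral_simple_compose[OF F] quad_rule_def sum_negf)
    have absa: "(\<Sum>i\<in>I. \<bar>a i\<bar> * g (y i)) = (LINT x|M. g (F m x)) + (\<Sum>i=1..Q. \<bar>w i\<bar> * g (x i))" for g
      by (simp add: sumI a_def y_def integral_simple_compose[OF F])
    \<comment> \<open>The probabilities contribute the 1.\<close>
    have "(\<Sum>i\<in>I. \<bar>a i\<bar>) = 1 + V" using absa[of "\<lambda>_. 1"] by (simp add: V_def prob_space[simplified])
    then have "(L m f)\<^sup>2 \<le> (rkhs_norm ip f)\<^sup>2 * ((\<Sum>n<N. (L m (\<psi> n))\<^sup>2) + (1 + V) * W m)"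
      using mercer_discrete_bound[OF mercer diag I f(1), of a y N] by (simp only: La absa[of ?T] W_def)
    also have "\<dots> \<le> 1 * ((\<Sum>n<N. (L m (\<psi> n))\<^sup>2) + (1 + V) * W m)"
    proof (rule mult_right_mono)
      show "(rkhs_norm ip f)\<^sup>2 \<le> 1"
        using f ip_nonneg by (simp add: rkhs_norm_def abs_square_le_1)
      have "?T z \<ge> 0" for z using partial[of "{..<N}" z] by simp
      then have "W m \<ge> 0" unfolding W_def by (intro add_nonneg_nonneg sum_nonneg integral_nonneg mult_nonneg_nonneg) auto
      then show "0 \<le> (\<Sum>n<N. (L m (\<psi> n))\<^sup>2) + (1 + V) * W m"
        by (intro add_nonneg_nonneg sum_nonneg mult_nonneg_nonneg) (auto simp: V_def sum_nonneg)
    qed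
    finally show ?thesis by simp
  qed
  moreover have "(\<lambda>m. (L m f)\<^sup>2) \<longlonglongrightarrow> ((LINT x|M. f x) - quad_rule Q w x f)\<^sup>2"
    unfolding L_def by (intro tendsto_intros lim f f1)
  moreover have "(\<lambda>m. (\<Sum>n<N. (L m (\<psi> n))\<^sup>2) + (1 + V) * W m) \<longlonglongrightarrow>
    (\<Sum>n<N. ((LINT x|M. \<psi> n x) - quad_rule Q w x (\<psi> n))\<^sup>2) +
    (1 + V) * ((LINT x|M. ?T x) + (\<Sum>i=1..Q. \<bar>w i\<bar> * ?T (x i)))"
    unfolding L_def W_def by (intro tendsto_intros lim cont psi1 Tc T1)
  ultimately show ?thesis unfolding V_def by (intro LIMSEQ_le) auto
qed

section \<open>Mercer expansion of the Gaussian kernel\<close>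

text \<open>A constant multiple of the functions integrated exactly, with \<open>\<beta>\<close> and
  \<open>\<delta>^2\<close> written in terms of \<open>r\<close>. The constant absorbs the root of
  the eigenvalue \<open>(1 - r) r^n\<close>, so that products sum to the kernel without
  weights.\<close>

definition mercer_fun :: "real \<Rightarrow> nat \<Rightarrow> real \<Rightarrow> real" where
  "mercer_fun r n x = sqrt (sqrt (1 - r\<^sup>2) * r ^ n / fact n) *
    (exp (- (r / (2 * (1 - r)) * x\<^sup>2)) * hermite n (sqrt ((1 + r) / (1 - r)) * x))"

context
  fixes r :: real
  assumes r: "0 < r" "r < 1"
begin

lemma one_minus_sq_pos: "1 - r\<^sup>2 > 0"
  using r by (simp add: abs_square_less_1)

lemma mercer_fun_mult:
  fixes x y :: real
  defines "b \<equiv> sqrt ((1 + r) / (1 - r))"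
  shows "mercer_fun r n x * mercer_fun r n y = sqrt (1 - r\<^sup>2) * exp (- (r / (2 * (1 - r)) * (x\<^sup>2 + y\<^sup>2))) *
    (hermite n (b * x) * hermite n (b * y) / fact n * r ^ n)"
proof -
  let ?p = "r / (2 * (1 - r))" and ?c = "sqrt (1 - r\<^sup>2) * r ^ n / fact n"
  have "?c \<ge> 0" using r one_minus_sq_pos by simp
  then have c: "sqrt ?c * sqrt ?c = ?c" by (rule real_sqrt_mult_self[THEN trans, OF abs_of_nonneg])
  have "mercer_fun r n x * mercer_fun r n y = (sqrt ?c * sqrt ?c) *
      ((exp (- (?p * x\<^sup>2)) * exp (- (?p * y\<^sup>2))) * (hermite n (b * x) * hermite n (b * y)))"
    unfolding mercer_fun_def b_def by (simp only: mult_ac)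
  also have "exp (- (?p * x\<^sup>2)) * exp (- (?p * y\<^sup>2)) = exp (- (?p * (x\<^sup>2 + y\<^sup>2)))"
    by (simp only: exp_add[symmetric] distrib_left minus_add_distrib)
  finally show ?thesis unfolding c by simp
qed

text \<open>Mehler's formula at \<open>\<beta> x\<close> and \<open>\<beta> y\<close>; the
  prefactors cancel and the two quadratic exponents combine to a multiple of
  \<open>(x - y)^2\<close>.\<close>

lemma mercer_expansion:
  assumes l: "1 / l\<^sup>2 = r / (1 - r)\<^sup>2"
  shows "(\<lambda>n. mercer_fun r n x * mercer_fun r n y) sums gauss_kernel l x y"
proof -
  define b where "b = sqrt ((1 + r) / (1 - r))"
  let ?E = "exp (- (r / (2 * (1 - r)) * (x\<^sup>2 + y\<^sup>2)))"
  let ?G = "(2 * r * (b * x) * (b * y) - r\<^sup>2 * ((b * x)\<^sup>2 + (b * y)\<^sup>2)) / (2 * (1 - r\<^sup>2))"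
  have "(\<lambda>n. mercer_fun r n x * mercer_fun r n y) sums (sqrt (1 - r\<^sup>2) * ?E * (exp ?G / sqrt (1 - r\<^sup>2)))"
    unfolding mercer_fun_mult b_def by (intro sums_mult mehler_formula) (use r in auto)
  moreover have "sqrt (1 - r\<^sup>2) * ?E * (exp ?G / sqrt (1 - r\<^sup>2)) = exp (- (r / (2 * (1 - r)) * (x\<^sup>2 + y\<^sup>2)) + ?G)"
    using one_minus_sq_pos by (simp only: exp_add) simp
  moreover have "- (r / (2 * (1 - r)) * (x\<^sup>2 + y\<^sup>2)) + ?G = - (x - y)\<^sup>2 / (2 * l\<^sup>2)"
  proof -
    have b2: "b\<^sup>2 = (1 + r) / (1 - r)" unfolding b_def using r by simp
    have "?G = b\<^sup>2 * (2 * r * x * y - r\<^sup>2 * (x\<^sup>2 + y\<^sup>2)) / (2 * (1 - r\<^sup>2))"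
      by (simp add: power2_eq_square algebra_simps)
    also have "\<dots> = (2 * r * x * y - r\<^sup>2 * (x\<^sup>2 + y\<^sup>2)) / (2 * (1 - r)\<^sup>2)"
    proof -
      have "(1 + r) / P * A / (2 * (P * (1 + r))) = A / (2 * (P * P))" for P A :: real
        using r by simp
      moreover have "1 - r\<^sup>2 = (1 - r) * (1 + r)" by (simp add: power2_eq_square algebra_simps)
      ultimately show ?thesis unfolding b2 power2_eq_square[of "1 - r"] by simp
    qed
    also have "- (r / (2 * (1 - r)) * (x\<^sup>2 + y\<^sup>2)) + \<dots> = - (x - y)\<^sup>2 * (r / (1 - r)\<^sup>2) / 2"
    proof -
      have "- (r / (2 * P) * S) + A / (2 * P\<^sup>2) = (A - r * P * S) / P\<^sup>2 / 2" if "P > 0" for P S A :: real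
        using that by (simp add: power2_eq_square field_simps)
      from this[of "1 - r"] have "- (r / (2 * (1 - r)) * S) + A / (2 * (1 - r)\<^sup>2) = (A - r * (1 - r) * S) / (1 - r)\<^sup>2 / 2" for S A
        using r by (simp only: diff_gt_0_iff_gt)
      moreover have "2 * r * x * y - r\<^sup>2 * (x\<^sup>2 + y\<^sup>2) - r * (1 - r) * (x\<^sup>2 + y\<^sup>2) = - (x - y)\<^sup>2 * r"
        by (simp add: power2_eq_square algebra_simps)
      ultimately show ?thesis by (simp only: times_divide_eq_right)
    qed
    also have "\<dots> = - (x - y)\<^sup>2 / (2 * l\<^sup>2)" unfolding l[symmetric] by simp
    finally show ?thesis .
  qed
  ultimately show ?thesis by (simp add: gauss_kernel_def)
qed

lemma continuous_mercer_fun: "continuous_on UNIV (mercer_fun r n)"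
  unfolding mercer_fun_def[abs_def] hermite_eq_poly by (intro continuous_intros)

text \<open>Since \<open>b^2 = 1 + 2 r / (1 - r)\<close>, the exponential in the square turns the
  standard density at \<open>x\<close> into that at \<open>b x\<close>. Substitution reduces the
  integral to the mean of \<open>H_n^2\<close>, and \<open>sqrt (1 - r^2) = (1 - r) b\<close>
  absorbs the Jacobian.\<close>

lemma mercer_fun_norm:
  "has_bochner_integral std_normal_distribution (\<lambda>x. (mercer_fun r n x)\<^sup>2) ((1 - r) * r ^ n)"
proof -
  define b where "b = sqrt ((1 + r) / (1 - r))"
  have b: "b > 0" "b\<^sup>2 = (1 + r) / (1 - r)" using r by (simp_all add: b_def)
  have "1 - r\<^sup>2 = ((1 - r) * b)\<^sup>2"
  proof -
    have "(1 - r)\<^sup>2 * ((1 + r) / (1 - r)) = (1 - r) * (1 + r)" using r by (simp add: power2_eq_square)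
    then show ?thesis unfolding power_mult_distrib b by (simp add: power2_eq_square algebra_simps)
  qed
  then have sq: "sqrt (1 - r\<^sup>2) = (1 - r) * b"
    using b r by (simp add: real_sqrt_abs)
  have "has_bochner_integral lborel (\<lambda>x. normal_density 0 1 x * poly (hermite_poly n * hermite_poly n) x) (fact n)"
    using integrable_normal_poly[of 1 "hermite_poly n * hermite_poly n"] hermite_orthogonal[of n n]
    by (simp add: has_bochner_integral_iff gaussian_mean_def)
  then have "has_bochner_integral lborel (\<lambda>x. std_normal_density (0 + b * x) * poly (hermite_poly n * hermite_poly n) (0 + b * x))
     (fact n /\<^sub>R \<bar>b\<bar>)"
    using b by (subst (asm) lborel_has_bochner_integral_real_affine_iff[of b _ _ 0]) auto
  then have "has_bochner_integral lborel
      (\<lambda>x. ((1 - r) * b * r ^ n / fact n) * (std_normal_density (0 + b * x) * poly (hermite_poly n * hermite_poly n) (0 + b * x)))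
      (((1 - r) * b * r ^ n / fact n) * (fact n /\<^sub>R \<bar>b\<bar>))"
    by (rule has_bochner_integral_mult_right)
  moreover have val: "((1 - r) * b * r ^ n / fact n) * (fact n /\<^sub>R \<bar>b\<bar>) = (1 - r) * r ^ n"
    using b by (simp add: field_simps)
  moreover have integrand: "((1 - r) * b * r ^ n / fact n) * (std_normal_density (0 + b * x) * poly (hermite_poly n * hermite_poly n) (0 + b * x))
      = std_normal_density x *\<^sub>R (mercer_fun r n x)\<^sup>2" for x
  proof -
    have "- (b * x)\<^sup>2 / 2 = - x\<^sup>2 / 2 + - (r / (2 * (1 - r)) * (x\<^sup>2 + x\<^sup>2))"
      using r unfolding power_mult_distrib b by (simp add: field_simps)
    then have "std_normal_density (b * x) = std_normal_density x * exp (- (r / (2 * (1 - r)) * (x\<^sup>2 + x\<^sup>2)))"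
      unfolding std_normal_density_def by (simp only: exp_add mult.assoc)
    then show ?thesis
      unfolding power2_eq_square[of "mercer_fun r n x"] mercer_fun_mult sq b_def[symmetric]
      by (simp add: hermite_eq_poly)
  qed
  ultimately have "has_bochner_integral lborel (\<lambda>x. std_normal_density x *\<^sub>R (mercer_fun r n x)\<^sup>2) ((1 - r) * r ^ n)"
    by (simp only:)
  moreover have "(\<lambda>x. (mercer_fun r n x)\<^sup>2) \<in> borel_measurable lborel"
    using borel_measurable_continuous_onI[OF continuous_mercer_fun[of n]] by simp
  ultimately show ?thesis
    by (subst has_bochner_integral_density) auto
qed

section \<open>Tail of the Mercer expansion\<close>

lemma mercer_tail_mean:
  "(LINT x|std_normal_distribution. 1 - (\<Sum>n<N. (mercer_fun r n x)\<^sup>2)) = r ^ N"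
proof -
  interpret real_distribution std_normal_distribution by (rule real_dist_normal_dist)
  have "has_bochner_integral std_normal_distribution (\<lambda>x. 1 - (\<Sum>n<N. (mercer_fun r n x)\<^sup>2)) (1 - (\<Sum>n<N. (1 - r) * r ^ n))"
    using prob_space
    by (intro has_bochner_integral_diff has_bochner_integral_sum mercer_fun_norm) (simp add: has_bochner_integral_iff)
  moreover have "1 - (\<Sum>n<N. (1 - r) * r ^ n) = r ^ N"
    using one_diff_power_eq[of r N] by (simp flip: sum_distrib_left)
  ultimately show ?thesis by (simp add: has_bochner_integral_iff)
qed

text \<open>For \<open>n \<ge> N\<close> the weight \<open>r\<^sup>n\<close> is at most \<open>(r/s)\<^sup>N s\<^sup>n\<close>, so the tail is controlled by Mehler's formula for \<open>s\<close>.\<close>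

lemma mercer_tail_bound:
  assumes s: "r < s" "s < 1" and x: "(1 + r) / (1 - r) * x\<^sup>2 \<le> 4 * real N"
  shows "1 - (\<Sum>n<N. (mercer_fun r n x)\<^sup>2) \<le>
    sqrt (1 - r\<^sup>2) / sqrt (1 - s\<^sup>2) * (r / s * exp (4 * (s / (1 + s) - r / (1 + r)))) ^ N"
proof -
  define u where "u = sqrt ((1 + r) / (1 - r)) * x"
  have u2: "u\<^sup>2 = (1 + r) / (1 - r) * x\<^sup>2" using r by (simp add: u_def power_mult_distrib)
  define E where "E = sqrt (1 - r\<^sup>2) * exp (- (r / (1 + r) * u\<^sup>2))"
  have E: "E > 0" using one_minus_sq_pos by (simp add: E_def)
  have psi: "(mercer_fun r n x)\<^sup>2 = E * (hermite n u * hermite n u / fact n * r ^ n)" for n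
  proof -
    have "r / (2 * (1 - r)) * (x\<^sup>2 + x\<^sup>2) = r / (1 + r) * u\<^sup>2"
    proof -
      have "r / (1 + r) * u\<^sup>2 = r / (1 - r) * x\<^sup>2" unfolding u2 using r by simp
      moreover have "r / (2 * P) * (X + X) = r / P * X" for P X :: real by (simp flip: mult_2)
      ultimately show ?thesis by (simp only:)
    qed
    then show ?thesis unfolding power2_eq_square[of "mercer_fun r n x"] mercer_fun_mult E_def u_def by simp
  qed
  define G where "G = exp ((2 * s * u * u - s\<^sup>2 * (u\<^sup>2 + u\<^sup>2)) / (2 * (1 - s\<^sup>2))) / sqrt (1 - s\<^sup>2)"
  have G: "(\<lambda>n. hermite n u * hermite n u / fact n * s ^ n) sums G"
    unfolding G_def using r s by (intro mehler_formula) auto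
  have s2: "1 - s\<^sup>2 > 0" using r s by (simp add: abs_square_less_1)
  \<comment> \<open>An auxiliary length-scale matching \<open>r\<close>, so that the expansion on
    the diagonal gives total sum 1.\<close>
  define l where "l = (1 - r) / sqrt r"
  have l: "1 / l\<^sup>2 = r / (1 - r)\<^sup>2" using r by (simp add: l_def power_divide)
  have one: "(\<lambda>n. (mercer_fun r n x)\<^sup>2) sums 1"
    using mercer_expansion[OF l, of x x] by (simp add: gauss_kernel_def power2_eq_square)
  have "(\<lambda>n. if n \<in> {..<N} then (mercer_fun r n x)\<^sup>2 else 0) sums (\<Sum>n<N. (mercer_fun r n x)\<^sup>2)"
    by (rule sums_If_finite_set) simp
  then have two: "(\<lambda>n. (if n \<in> {..<N} then (mercer_fun r n x)\<^sup>2 else 0) +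
      E * (r / s) ^ N * (hermite n u * hermite n u / fact n * s ^ n))
      sums ((\<Sum>n<N. (mercer_fun r n x)\<^sup>2) + E * (r / s) ^ N * G)"
    by (intro sums_add sums_mult G)
  have "1 \<le> (\<Sum>n<N. (mercer_fun r n x)\<^sup>2) + E * (r / s) ^ N * G"
  proof (rule sums_le[OF _ one two])
    fix n
    show "(mercer_fun r n x)\<^sup>2 \<le> (if n \<in> {..<N} then (mercer_fun r n x)\<^sup>2 else 0) +
      E * (r / s) ^ N * (hermite n u * hermite n u / fact n * s ^ n)"
    proof (cases "n < N")
      case True
      then show ?thesis using E r s by simp
    next
      case False
      have "r ^ n = (r / s) ^ n * s ^ n" using r s by (simp add: power_divide)
      also have "\<dots> \<le> (r / s) ^ N * s ^ n"
        using False r s by (intro mult_right_mono power_decreasing) auto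
      finally have "(E * (hermite n u * hermite n u / fact n)) * r ^ n \<le> (E * (hermite n u * hermite n u / fact n)) * ((r / s) ^ N * s ^ n)"
        using E by (intro mult_left_mono) auto
      then show ?thesis using False by (simp add: psi mult_ac)
    qed
  qed
  also have "E * (r / s) ^ N * G = sqrt (1 - r\<^sup>2) / sqrt (1 - s\<^sup>2) * ((r / s) ^ N * exp ((s / (1 + s) - r / (1 + r)) * u\<^sup>2))"
  proof -
    \<comment> \<open>With equal arguments the factor \<open>2 (1 - s)\<close> cancels from Mehler's
      exponent.\<close>
    have "(2 * s * u * u - s\<^sup>2 * (u\<^sup>2 + u\<^sup>2)) / (2 * (1 - s\<^sup>2)) = (2 * (1 - s)) * (s * u\<^sup>2) / ((2 * (1 - s)) * (1 + s))"
      by (simp add: power2_eq_square algebra_simps)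
    also have "\<dots> = s / (1 + s) * u\<^sup>2" using s by simp
    finally have "G = exp (s / (1 + s) * u\<^sup>2) / sqrt (1 - s\<^sup>2)" by (simp only: G_def)
    moreover have "A * exp (- p) * q * (exp z / B) = A / B * (q * exp (z - p))" for A B p q z :: real
      by (simp add: exp_diff exp_minus divide_inverse)
    ultimately show ?thesis unfolding E_def left_diff_distrib by (simp only:)
  qed
  also have "\<dots> \<le> sqrt (1 - r\<^sup>2) / sqrt (1 - s\<^sup>2) * ((r / s) ^ N * exp ((s / (1 + s) - r / (1 + r)) * (4 * real N)))"
  proof -
    have "s / (1 + s) - r / (1 + r) \<ge> 0" using r s by (simp add: field_simps)
    then have "(s / (1 + s) - r / (1 + r)) * u\<^sup>2 \<le> (s / (1 + s) - r / (1 + r)) * (4 * real N)"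
      using x unfolding u2 by (rule mult_left_mono[rotated])
    then show ?thesis using s2 one_minus_sq_pos r s by (intro mult_left_mono) auto
  qed
  also have "(s / (1 + s) - r / (1 + r)) * (4 * real N) = real N * (4 * (s / (1 + s) - r / (1 + r)))"
    by (simp only: mult_ac)
  also have "(r / s) ^ N * exp \<dots> = (r / s * exp (4 * (s / (1 + s) - r / (1 + r)))) ^ N"
    by (simp only: exp_of_nat_mult power_mult_distrib)
  finally show ?thesis by simp
qed

text \<open>After taking logarithms the claim compares the strictly increasing function
  \<open>?f\<close> at \<open>r\<close> and \<open>s\<close>.\<close>

lemma mercer_decay_rate:
  assumes s: "r < s" "s < 1"
  shows "r / s * exp (4 * (s / (1 + s) - r / (1 + r))) < 1"
proof -
  let ?f = "\<lambda>t. ln t - 4 * (t / (1 + t))"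
  have deriv: "\<exists>d. ((\<lambda>t. ln t - 4 * (t / (1 + t))) has_real_derivative d) (at t) \<and> d > 0" if t: "r < t" "t < s" for t
  proof (intro exI conjI)
    show "((\<lambda>t. ln t - 4 * (t / (1 + t))) has_real_derivative (1 / t - 4 / (1 + t)\<^sup>2)) (at t)"
    proof -
      have "((\<lambda>t. t / (1 + t)) has_real_derivative 1 / (1 + t)\<^sup>2) (at t)"
        using r t by (auto intro!: derivative_eq_intros simp: power2_eq_square)
      from DERIV_diff[OF DERIV_ln_divide[of t] DERIV_cmult[OF this, of 4]] show ?thesis
        using r t by simp
    qed
    have "1 / t - 4 / (1 + t)\<^sup>2 = (1 - t)\<^sup>2 / (t * (1 + t)\<^sup>2)"
      using r t by (simp add: divide_simps) (simp add: power2_eq_square algebra_simps)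
    then show "1 / t - 4 / (1 + t)\<^sup>2 > 0" using r t s by simp
  qed
  have cont: "continuous_on {r..s} ?f"
    using r by (intro continuous_intros) auto
  have "?f r < ?f s"
    by (rule DERIV_pos_imp_increasing_open[where f = ?f, OF s(1) deriv cont])
  then have "ln r + 4 * (s / (1 + s) - r / (1 + r)) < ln s" by (simp add: right_diff_distrib)
  then have "exp (ln r + 4 * (s / (1 + s) - r / (1 + r))) < exp (ln s)" by (simp only: exp_less_cancel_iff)
  then show ?thesis using r s by (simp add: exp_add)
qed

end

section \<open>Worst-case errors\<close>

text \<open>Differences of values are bounded by the norm times the kernel distance of the two
  points, which tends to 0. Continuity is what the discretisation argument requires of
  \<open>f\<close>.\<close>

lemma gauss_rkhs_continuous:
  assumes "rkhs (gauss_kernel l) H ip" and f: "f \<in> H"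
  shows "continuous_on UNIV f"
proof -
  interpret rkhs "gauss_kernel l" H ip by fact
  let ?C = "rkhs_norm ip f"
  have "isCont f y" for y
  proof -
    have "isCont (\<lambda>x. ?C * sqrt (gauss_kernel l x x - 2 * gauss_kernel l x y + gauss_kernel l y y)) y"
      unfolding gauss_kernel_def divide_inverse by (intro continuous_intros)
    then have "((\<lambda>x. ?C * sqrt (gauss_kernel l x x - 2 * gauss_kernel l x y + gauss_kernel l y y))
        \<longlongrightarrow> 0) (at y)" by (simp add: isCont_def gauss_kernel_def)
    then have "((\<lambda>x. f x - f y) \<longlongrightarrow> 0) (at y)"
      by (rule Lim_null_comparison[rotated]) (simp add: abs_eval_diff_le[OF f])
    then show ?thesis by (simp add: isCont_def LIM_zero_iff)
  qed
  then show ?thesis by (simp add: continuous_at_imp_continuous_on)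
qed

text \<open>
  The error functional of the kernel quadrature rule vanishes on the span of the kernel sections at
  the nodes, and on the orthogonal complement all rules with these nodes agree.
\<close>

lemma kernel_quad_error_attained:
  assumes rkhs: "rkhs (gauss_kernel l) H ip" and kw: "kernel_quad_weights (gauss_kernel l) N x w"
    and f: "f \<in> H" "rkhs_norm ip f \<le> 1"
  obtains g where "g \<in> H" "rkhs_norm ip g \<le> 1"
    and "\<And>w'. (LINT y|std_normal_distribution. f y) - quad_rule N w x f =
      (LINT y|std_normal_distribution. g y) - quad_rule N w' x g"
proof -
  interpret rkhs "gauss_kernel l" H ip by fact
  let ?k = "gauss_kernel l" and ?M = std_normal_distribution
  define S where "S = x ` {1..N}"
  have S: "finite S" by (simp add: S_def)
  obtain c where c: "\<And>s. s \<in> S \<Longrightarrow> f s - (\<Sum>t\<in>S. c t * ?k t s) = 0"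
    using interpolation_residual[OF S f(1)] by blast
  have mem: "(\<lambda>x. c t * ?k t x) \<in> H" for t by (intro scale_mem kernel_mem)
  define v where "v = (\<lambda>s. \<Sum>t\<in>S. c t * ?k t s)"
  define g where "g = (\<lambda>s. f s - v s)"
  have v: "v \<in> H" unfolding v_def by (intro sum_mem S mem)
  have g: "g \<in> H" unfolding g_def by (intro diff_mem f v)
  have g0: "g s = 0" if "s \<in> S" for s using c[OF that] by (simp add: g_def v_def)
  have "ip g v = ip v g" using ip_commute g v by blast
  also have "\<dots> = (\<Sum>t\<in>S. ip (\<lambda>x. c t * ?k t x) g)"
    unfolding v_def by (intro ip_sum_left S mem g)
  also have "\<dots> = 0"
    using g kernel_mem g0 by (intro sum.neutral ballI) (simp add: ip_scale_left ip_commute[of "?k _"] reproducing)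
  \<comment> \<open>Orthogonality of \<open>g\<close> and \<open>v\<close> gives this, and
    Cauchy-Schwarz then shows that the residual stays in the unit ball.\<close>
  finally have "ip g g = ip g f"
    using ip_diff_right[OF f(1) v g] unfolding g_def[symmetric] by simp
  also have "\<dots> \<le> rkhs_norm ip g * rkhs_norm ip f"
    using Cauchy_Schwarz[OF g f(1)] by simp
  also have "\<dots> \<le> rkhs_norm ip g * 1"
    using f(2) ip_nonneg[OF g] by (intro mult_left_mono) (auto simp: rkhs_norm_def)
  finally have "sqrt (ip g g) * sqrt (ip g g) \<le> sqrt (ip g g) * 1"
    using ip_nonneg[OF g] by (simp add: rkhs_norm_def)
  then have norm: "rkhs_norm ip g \<le> 1"
    using ip_nonneg[OF g] unfolding rkhs_norm_def mult_le_cancel_left by (cases "ip g g = 0") auto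
  have int: "integrable ?M h" if "h \<in> H" for h using gauss_rkhs_integrable[OF rkhs that] .
  \<comment> \<open>The linear system for the weights says that the kernel sections at the nodes are
    integrated exactly.\<close>
  have "(LINT y|?M. v y) = (\<Sum>t\<in>S. c t * (LINT y|?M. ?k t y))"
    unfolding v_def using int[OF kernel_mem] by (subst Bochner_Integration.integral_sum) auto
  also have "\<dots> = (\<Sum>t\<in>S. c t * (\<Sum>j=1..N. ?k t (x j) * w j))"
    using kw by (intro sum.cong refl) (auto simp: S_def kernel_quad_weights_def)
  also have "\<dots> = quad_rule N w x v"
    unfolding quad_rule_def v_def by (simp add: sum_distrib_left sum.swap[of _ S] mult_ac)
  finally have Lv: "(LINT y|?M. v y) = quad_rule N w x v" .
  have Q0: "quad_rule N w' x g = 0" for w'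
    unfolding quad_rule_def using g0 by (intro sum.neutral) (auto simp: S_def)
  have "(LINT y|?M. g y) = (LINT y|?M. f y) - (LINT y|?M. v y)"
    unfolding g_def using int f v by (intro Bochner_Integration.integral_diff) auto
  moreover have "quad_rule N w x g = quad_rule N w x f - quad_rule N w x v"
    unfolding quad_rule_def g_def by (simp add: right_diff_distrib sum_subtractf)
  ultimately show thesis using g norm Lv Q0 by (intro that[of g]) auto
qed

text \<open>Every error of the kernel rule on the unit ball is also an error of the competing rule,
  at the residual \<open>g\<close>.\<close>

lemma kernel_quad_optimal:
  assumes rkhs: "rkhs (gauss_kernel l) H ip" and kw: "kernel_quad_weights (gauss_kernel l) N x w"
  shows "worst_case_error H ip (quad_rule N w x) \<le> worst_case_error H ip (quad_rule N w' x)"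
  unfolding worst_case_error_def
proof (rule cSUP_least)
  show "{f \<in> H. rkhs_norm ip f \<le> 1} \<noteq> {}" by (rule gauss_rkhs_worst_case_error_bdd[OF rkhs])
  fix f assume "f \<in> {f \<in> H. rkhs_norm ip f \<le> 1}"
  then have "f \<in> H" "rkhs_norm ip f \<le> 1" by auto
  then obtain g where g: "g \<in> H" "rkhs_norm ip g \<le> 1"
    and eq: "\<And>w'. (LINT y|std_normal_distribution. f y) - quad_rule N w x f =
      (LINT y|std_normal_distribution. g y) - quad_rule N w' x g"
    using kernel_quad_error_attained[OF rkhs kw] by blast
  show "\<bar>(LINT y|std_normal_distribution. f y) - quad_rule N w x f\<bar> \<le>
      (SUP f\<in>{f \<in> H. rkhs_norm ip f \<le> 1}. \<bar>(LINT x|std_normal_distribution. f x) - quad_rule N w' x f\<bar>)"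
    unfolding eq[of w'] using g
    by (intro cSUP_upper gauss_rkhs_worst_case_error_bdd[OF rkhs]) simp
qed

section \<open>The parameter \<open>r\<close> and the error bound for the approximate rule\<close>

lemma gq_parameters:
  assumes "l > 0"
  obtains r where "0 < r" "r < 1" "gq_beta l = sqrt ((1 + r) / (1 - r))"
    "gq_delta2 l = r / (2 * (1 - r))" "1 / l\<^sup>2 = r / (1 - r)\<^sup>2"
proof -
  define B where "B = (gq_beta l)\<^sup>2"
  have B: "B > 1" "B\<^sup>2 = 1 + 4 / l\<^sup>2" using assms by (simp_all add: B_def gq_beta_sq)
  \<comment> \<open>Solves \<open>(1 + r) / (1 - r) = \<beta>^2\<close>.\<close>
  define r where "r = (B - 1) / (B + 1)"
  have 1: "1 + r = 2 * B / (B + 1)" "1 - r = 2 / (B + 1)" using B(1) by (simp_all add: r_def field_simps)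
  have "0 < r" "r < 1" using B(1) by (simp_all add: r_def)
  moreover have "(1 + r) / (1 - r) = B" unfolding 1 using B(1) by simp
  then have "gq_beta l = sqrt ((1 + r) / (1 - r))"
    using gq_beta_pos[of l] by (simp add: B_def)
  moreover have "gq_delta2 l = r / (2 * (1 - r))"
    unfolding 1 gq_delta2_def B_def[symmetric] using B(1) by (simp add: r_def gq_alpha_def power_divide)
  moreover have "r / (1 - r)\<^sup>2 = (B\<^sup>2 - 1) / 4"
    unfolding 1 r_def using B(1) by (simp add: power_divide power2_eq_square field_simps)
  then have "1 / l\<^sup>2 = r / (1 - r)\<^sup>2" using B(2) by simp
  ultimately show thesis by (rule that)
qed

text \<open>Exactness removes the leading sum from the squared error. The measure contributes the
  tail mean \<open>r^N\<close> and the nodes contribute at most \<open>C K \<rho>^N\<close>;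
  \<open>max r \<rho>\<close> dominates both rates, and the outer roots return from squared errors
  to errors.\<close>

lemma worst_case_error_approx_bound:
  fixes l r s :: real
  assumes rkhs: "rkhs (gauss_kernel l) H ip" and gh: "gauss_hermite_rule N x w"
    and r: "0 < r" "r < 1" and s: "r < s" "s < 1"
    and beta: "gq_beta l = sqrt ((1 + r) / (1 - r))" and delta: "gq_delta2 l = r / (2 * (1 - r))"
    and l: "1 / l\<^sup>2 = r / (1 - r)\<^sup>2"
    and C: "(\<Sum>n=1..N. \<bar>approx_weights l N x w n\<bar>) \<le> C"
  defines "\<rho> \<equiv> r / s * exp (4 * (s / (1 + s) - r / (1 + r)))"
  defines "K \<equiv> sqrt (1 - r\<^sup>2) / sqrt (1 - s\<^sup>2)"
  shows "0 \<le> worst_case_error H ip (quad_rule N (approx_weights l N x w) (scaled_nodes l x))"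
    and "worst_case_error H ip (quad_rule N (approx_weights l N x w) (scaled_nodes l x))
      \<le> sqrt ((1 + C) * (1 + C * K)) * (sqrt (max r \<rho>)) ^ N"
proof -
  let ?M = std_normal_distribution and ?w = "approx_weights l N x w" and ?x = "scaled_nodes l x"
  interpret rkhs "gauss_kernel l" H ip by fact
  note bdd = gauss_rkhs_worst_case_error_bdd[OF rkhs]
  obtain f0 where "f0 \<in> {f \<in> H. rkhs_norm ip f \<le> 1}" using bdd(1) by blast
  then show "0 \<le> worst_case_error H ip (quad_rule N ?w ?x)"
    unfolding worst_case_error_def by (intro cSUP_upper2[OF bdd(2)]) auto
  have K: "K \<ge> 0" using r s by (simp add: K_def abs_square_le_1)
  have C0: "C \<ge> 0" by (rule order_trans[OF _ C]) (simp add: sum_nonneg)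
  have exact: "(LINT y|?M. mercer_fun r n y) = quad_rule N ?w ?x (mercer_fun r n)" if n: "n < N" for n
  proof -
    define c where "c = sqrt (sqrt (1 - r\<^sup>2) * r ^ n / fact n)"
    define \<phi> where "\<phi> = (\<lambda>y. exp (- (gq_delta2 l * y\<^sup>2)) * hermite n (gq_beta l * y))"
    \<comment> \<open>The Mercer functions are multiples of the functions for which exactness was
      shown, so it carries over by linearity.\<close>
    have m: "mercer_fun r n = (\<lambda>y. c * \<phi> y)"
      by (simp add: fun_eq_iff mercer_fun_def c_def \<phi>_def beta delta)
    have "quad_rule N ?w ?x \<phi> = (LINT y|?M. \<phi> y)"
      unfolding \<phi>_def by (rule approx_weights_exact[OF gh n])
    moreover have "quad_rule N ?w ?x (mercer_fun r n) = c * quad_rule N ?w ?x \<phi>"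
      by (simp add: m quad_rule_def sum_distrib_left mult_ac)
    ultimately show ?thesis by (simp add: m)
  qed
  have tail: "1 - (\<Sum>n<N. (mercer_fun r n (?x i))\<^sup>2) \<le> K * \<rho> ^ N" if i: "i \<in> {1..N}" for i
    unfolding K_def \<rho>_def
  proof (rule mercer_tail_bound[OF r s])
    have "hermite N (x i) = 0"
      using gh i by (auto simp: gauss_hermite_rule_def bij_betw_def)
    then have "(x i)\<^sup>2 \<le> 4 * real N" by (rule hermite_zero_bound)
    moreover have "(gq_beta l)\<^sup>2 = (1 + r) / (1 - r)" unfolding beta using r by simp
    then have "(1 + r) / (1 - r) * (?x i)\<^sup>2 = (x i)\<^sup>2"
      using gq_beta_pos[of l] by (simp add: scaled_nodes_def power_divide flip: \<open>(gq_beta l)\<^sup>2 = _\<close>)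
    ultimately show "(1 + r) / (1 - r) * (?x i)\<^sup>2 \<le> 4 * real N" by simp
  qed
  have rho: "\<rho> > 0" using r s by (simp add: \<rho>_def)
  show "worst_case_error H ip (quad_rule N ?w ?x) \<le> sqrt ((1 + C) * (1 + C * K)) * (sqrt (max r \<rho>)) ^ N"
    unfolding worst_case_error_def
  proof (rule cSUP_least[OF bdd(1)])
    fix f assume "f \<in> {f \<in> H. rkhs_norm ip f \<le> 1}"
    then have f: "f \<in> H" "rkhs_norm ip f \<le> 1" by auto
    let ?e = "(LINT y|?M. f y) - quad_rule N ?w ?x f" and ?T = "\<lambda>y. 1 - (\<Sum>n<N. (mercer_fun r n y)\<^sup>2)"
    have "?e\<^sup>2 \<le> (\<Sum>n<N. ((LINT y|?M. mercer_fun r n y) - quad_rule N ?w ?x (mercer_fun r n))\<^sup>2) +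
        (1 + (\<Sum>i=1..N. \<bar>?w i\<bar>)) * ((LINT y|?M. ?T y) + (\<Sum>i=1..N. \<bar>?w i\<bar> * ?T (?x i)))"
      by (rule mercer_error_bound[OF rkhs real_dist_normal_dist mercer_expansion[OF r l] _
            continuous_mercer_fun f gauss_rkhs_continuous[OF rkhs f(1)]]) (simp_all add: gauss_kernel_def r)
    also have "\<dots> = (1 + (\<Sum>i=1..N. \<bar>?w i\<bar>)) * (r ^ N + (\<Sum>i=1..N. \<bar>?w i\<bar> * ?T (?x i)))"
      using exact by (simp add: mercer_tail_mean[OF r])
    also have "\<dots> \<le> (1 + (\<Sum>i=1..N. \<bar>?w i\<bar>)) * (r ^ N + (\<Sum>i=1..N. \<bar>?w i\<bar> * (K * \<rho> ^ N)))"
      using tail by (intro mult_left_mono add_left_mono sum_mono) (auto intro!: add_nonneg_nonneg sum_nonneg)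
    also have "\<dots> = (1 + (\<Sum>i=1..N. \<bar>?w i\<bar>)) * (r ^ N + (\<Sum>i=1..N. \<bar>?w i\<bar>) * (K * \<rho> ^ N))"
      by (simp only: sum_distrib_right)
    also have "\<dots> \<le> (1 + C) * (r ^ N + C * (K * \<rho> ^ N))"
      using C C0 K r rho by (intro mult_mono add_mono add_nonneg_nonneg mult_nonneg_nonneg sum_nonneg) auto
    also have "\<dots> \<le> (1 + C) * (max r \<rho> ^ N + C * (K * max r \<rho> ^ N))"
      using C0 K r rho by (intro mult_left_mono add_mono power_mono) auto
    also have "\<dots> = (1 + C) * (1 + C * K) * max r \<rho> ^ N" by (simp add: algebra_simps)
    finally have "sqrt (?e\<^sup>2) \<le> sqrt ((1 + C) * (1 + C * K) * max r \<rho> ^ N)" by (rule real_sqrt_le_mono)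
    then show "\<bar>?e\<bar> \<le> sqrt ((1 + C) * (1 + C * K)) * (sqrt (max r \<rho>)) ^ N"
      by (simp only: real_sqrt_abs) (simp only: real_sqrt_mult real_sqrt_power)
  qed
qed

theorem theorem3p2:
  fixes l :: real
    and H :: "(real \<Rightarrow> real) set"
    and ip :: "(real \<Rightarrow> real) \<Rightarrow> (real \<Rightarrow> real) \<Rightarrow> real"
    and xGH wGH wk :: "nat \<Rightarrow> nat \<Rightarrow> real"
  assumes "l > 0"
    and "rkhs (gauss_kernel l) H ip"
    and "\<And>N. N \<ge> 1 \<Longrightarrow> gauss_hermite_rule N (xGH N) (wGH N)"
    and "\<And>N. N \<ge> 1 \<Longrightarrow> kernel_quad_weights (gauss_kernel l) N (scaled_nodes l (xGH N)) (wk N)"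
    and "bdd_above ((\<lambda>N. \<Sum>n=1..N. \<bar>approx_weights l N (xGH N) (wGH N) n\<bar>) ` {1..})"
  shows "(\<forall>N\<ge>1.
      worst_case_error H ip (quad_rule N (wk N) (scaled_nodes l (xGH N)))
        \<le> worst_case_error H ip
            (quad_rule N (approx_weights l N (xGH N) (wGH N)) (scaled_nodes l (xGH N)))) \<and>
    (\<exists>\<eta>::real. 0 < \<eta> \<and> \<eta> < 1 \<and>
      (\<lambda>N. worst_case_error H ip
            (quad_rule N (approx_weights l N (xGH N) (wGH N)) (scaled_nodes l (xGH N))))
        \<in> O(\<lambda>N. \<eta> ^ N))"
proof (intro conjI allI impI)
  show "worst_case_error H ip (quad_rule N (wk N) (scaled_nodes l (xGH N)))
      \<le> worst_case_error H ip (quad_rule N (approx_weights l N (xGH N) (wGH N)) (scaled_nodes l (xGH N)))"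
    if "N \<ge> 1" for N
    by (rule kernel_quad_optimal[OF assms(2) assms(4)[OF that]])
next
  obtain r where r: "0 < r" "r < 1" and par: "gq_beta l = sqrt ((1 + r) / (1 - r))"
      "gq_delta2 l = r / (2 * (1 - r))" "1 / l\<^sup>2 = r / (1 - r)\<^sup>2"
    using gq_parameters[OF assms(1)] by blast
  \<comment> \<open>Any intermediate point serves: the decay rate is below 1 for each of
    them.\<close>
  obtain s where s: "r < s" "s < 1" using dense[OF r(2)] by blast
  obtain C where C: "\<And>N. N \<ge> 1 \<Longrightarrow> (\<Sum>n=1..N. \<bar>approx_weights l N (xGH N) (wGH N) n\<bar>) \<le> C"
    using assms(5) unfolding bdd_above_def by auto
  let ?e = "\<lambda>N. worst_case_error H ip (quad_rule N (approx_weights l N (xGH N) (wGH N)) (scaled_nodes l (xGH N)))"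
  define \<rho> where "\<rho> = r / s * exp (4 * (s / (1 + s) - r / (1 + r)))"
  define K where "K = sqrt (1 - r\<^sup>2) / sqrt (1 - s\<^sup>2)"
  define \<eta> where "\<eta> = sqrt (max r \<rho>)"
  have eta: "0 < \<eta>" "\<eta> < 1"
    using r mercer_decay_rate[OF r s] by (auto simp: \<eta>_def \<rho>_def)
  have "norm (?e N) \<le> sqrt ((1 + C) * (1 + C * K)) * norm (\<eta> ^ N)" if "N \<ge> 1" for N
    using worst_case_error_approx_bound[OF assms(2) assms(3)[OF that] r s par C[OF that]] eta
    by (simp add: \<eta>_def \<rho>_def K_def)
  then have "?e \<in> O(\<lambda>N. \<eta> ^ N)"
    \<comment> \<open>The bound is available from \<open>N = 1\<close> on, which an asymptotic
      statement permits.\<close>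
    by (intro bigoI eventually_sequentiallyI[of 1]) auto
  with eta show "\<exists>\<eta>::real. 0 < \<eta> \<and> \<eta> < 1 \<and> ?e \<in> O(\<lambda>N. \<eta> ^ N)" by blast
qed

end
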